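(* Let $v$ be a vertex that has all iterated bases defined, and let $p$ be an $\mathrm{evenlevel}(v)$ path or an $\mathrm{oddlevel}(v)$ path. Then for each vertex $u$ on $p$, all iterated bases of $u$ lie on $p$.
   Context: $G=(V,E)$ is a finite undirected graph with a matching $M$, with at least one unmatched vertex. Alternating paths are simple paths alternating between unmatched edges (not in $M$) and matched edges (in $M$), starting with an unmatched edge when starting at an unmatched vertex. $l_m$ is the minimum length of an augmenting path (alternating path between two distinct unmatched vertices), $\infty$ if none. $\mathrm{evenlevel}(v)$, $\mathrm{oddlevel}(v)$ are the minimum lengths of even, resp. odd, alternating paths from an unmatched vertex to $v$ ($\infty$ if none); such minimum paths are $\mathrm{evenlevel}(v)$, $\mathrm{oddlevel}(v)$ paths. Tenacity $t(v)=\mathrm{evenlevel}(v)+\mathrm{oddlevel}(v)$. For $t(v)=t<l_m$, $\mathrm{base}(v)$ is the vertex of tenacity $>t$ furthest from the starting unmatched vertex along any $\mathrm{evenlevel}(v)$ or $\mathrm{oddlevel}(v)$ path (known to be independent of the path). Iterated bases: $\mathrm{base}^1(v)=\mathrm{base}(v)$, and $\mathrm{base}^{k+1}(v)=\mathrm{base}(\mathrm{base}^k(v))$ whenever $t(\mathrm{base}^k(v))<l_m$. A vertex $v$ has all iterated bases defined if $\mathrm{base}^k(v)$ is defined and is an unmatched vertex for some $k\in\mathbb{Z}^+$. *)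

theory Defs
  imports "HOL-Library.Extended_Nat"
begin

definition finite_graph :: "'a set \<Rightarrow> 'a set set \<Rightarrow> bool" where
  "finite_graph V E \<longleftrightarrow> finite V \<and> (\<forall>e\<in>E. e \<subseteq> V \<and> card e = 2)"

definition matching :: "'a set set \<Rightarrow> 'a set set \<Rightarrow> bool" where
  "matching E M \<longleftrightarrow> M \<subseteq> E \<and> (\<forall>e\<in>M. \<forall>e'\<in>M. e \<noteq> e' \<longrightarrow> e \<inter> e' = {})"

definition unmatched :: "'a set \<Rightarrow> 'a set set \<Rightarrow> 'a \<Rightarrow> bool" where
  "unmatched V M v \<longleftrightarrow> v \<in> V \<and> v \<notin> \<Union>M"

text \<open>A path is the nonempty list of its vertices; its length is its number of edges, so that a
  single vertex is a path of length 0. If the first vertex is unmatched, the first edge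
  is necessarily outside \<open>M\<close>.\<close>

definition alternating_path :: "'a set \<Rightarrow> 'a set set \<Rightarrow> 'a set set \<Rightarrow> 'a list \<Rightarrow> bool" where
  "alternating_path V E M p \<longleftrightarrow>
     p \<noteq> [] \<and> distinct p \<and> set p \<subseteq> V \<and>
     (\<forall>i. i + 1 < length p \<longrightarrow> {p ! i, p ! (i + 1)} \<in> E) \<and>
     (\<forall>i. i + 2 < length p \<longrightarrow>
        ({p ! i, p ! (i + 1)} \<in> M \<longleftrightarrow> {p ! (i + 1), p ! (i + 2)} \<notin> M))"

definition path_length :: "'a list \<Rightarrow> nat" where
  "path_length p = length p - 1"

definition augmenting_path :: "'a set \<Rightarrow> 'a set set \<Rightarrow> 'a set set \<Rightarrow> 'a list \<Rightarrow> bool" where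
  "augmenting_path V E M p \<longleftrightarrow>
     alternating_path V E M p \<and> unmatched V M (hd p) \<and> unmatched V M (last p) \<and> hd p \<noteq> last p"

text \<open>The infimum of the empty set in \<^typ>\<open>enat\<close> is \<open>\<infinity>\<close>.\<close>

definition min_augmenting_length :: "'a set \<Rightarrow> 'a set set \<Rightarrow> 'a set set \<Rightarrow> enat" where
  "min_augmenting_length V E M = Inf {enat (path_length p) | p. augmenting_path V E M p}"

definition alternating_path_to ::
    "'a set \<Rightarrow> 'a set set \<Rightarrow> 'a set set \<Rightarrow> 'a \<Rightarrow> 'a list \<Rightarrow> bool" where
  "alternating_path_to V E M v p \<longleftrightarrow>
     alternating_path V E M p \<and> unmatched V M (hd p) \<and> last p = v"

definition evenlevel :: "'a set \<Rightarrow> 'a set set \<Rightarrow> 'a set set \<Rightarrow> 'a \<Rightarrow> enat" where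
  "evenlevel V E M v =
     Inf {enat (path_length p) | p. alternating_path_to V E M v p \<and> even (path_length p)}"

definition oddlevel :: "'a set \<Rightarrow> 'a set set \<Rightarrow> 'a set set \<Rightarrow> 'a \<Rightarrow> enat" where
  "oddlevel V E M v =
     Inf {enat (path_length p) | p. alternating_path_to V E M v p \<and> odd (path_length p)}"

definition evenlevel_path ::
    "'a set \<Rightarrow> 'a set set \<Rightarrow> 'a set set \<Rightarrow> 'a \<Rightarrow> 'a list \<Rightarrow> bool" where
  "evenlevel_path V E M v p \<longleftrightarrow>
     alternating_path_to V E M v p \<and> even (path_length p) \<and>
     enat (path_length p) = evenlevel V E M v"

definition oddlevel_path ::
    "'a set \<Rightarrow> 'a set set \<Rightarrow> 'a set set \<Rightarrow> 'a \<Rightarrow> 'a list \<Rightarrow> bool" where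
  "oddlevel_path V E M v p \<longleftrightarrow>
     alternating_path_to V E M v p \<and> odd (path_length p) \<and>
     enat (path_length p) = oddlevel V E M v"

definition tenacity :: "'a set \<Rightarrow> 'a set set \<Rightarrow> 'a set set \<Rightarrow> 'a \<Rightarrow> enat" where
  "tenacity V E M v = evenlevel V E M v + oddlevel V E M v"

definition furthest_of_higher_tenacity ::
    "'a set \<Rightarrow> 'a set set \<Rightarrow> 'a set set \<Rightarrow> enat \<Rightarrow> 'a list \<Rightarrow> 'a \<Rightarrow> bool" where
  "furthest_of_higher_tenacity V E M t p b \<longleftrightarrow>
     (\<exists>i < length p. b = p ! i \<and> tenacity V E M b > t \<and>
        (\<forall>j < length p. tenacity V E M (p ! j) > t \<longrightarrow> j \<le> i))"

text \<open>Only meaningful when the tenacity of \<open>v\<close> is smaller than the minimum length of an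
  augmenting path; there the vertex does not depend on the chosen path, a fact
  that is not built into any hypothesis.\<close>

definition base :: "'a set \<Rightarrow> 'a set set \<Rightarrow> 'a set set \<Rightarrow> 'a \<Rightarrow> 'a" where
  "base V E M v =
     (THE b. \<forall>p. evenlevel_path V E M v p \<or> oddlevel_path V E M v p \<longrightarrow>
        furthest_of_higher_tenacity V E M (tenacity V E M v) p b)"

text \<open>\<open>iterated_base V E M v k b\<close> says that the \<open>k\<close>-th iterated base of \<open>v\<close> is defined
  and equal to \<open>b\<close>.\<close>

inductive iterated_base ::
    "'a set \<Rightarrow> 'a set set \<Rightarrow> 'a set set \<Rightarrow> 'a \<Rightarrow> nat \<Rightarrow> 'a \<Rightarrow> bool"
  for V E M v where
  first: "tenacity V E M v < min_augmenting_length V E M \<Longrightarrow>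
            iterated_base V E M v 1 (base V E M v)"
| step: "iterated_base V E M v k b \<Longrightarrow>
            tenacity V E M b < min_augmenting_length V E M \<Longrightarrow>
            iterated_base V E M v (Suc k) (base V E M b)"

definition all_iterated_bases_defined ::
    "'a set \<Rightarrow> 'a set set \<Rightarrow> 'a set set \<Rightarrow> 'a \<Rightarrow> bool" where
  "all_iterated_bases_defined V E M v \<longleftrightarrow>
     (\<exists>k b. iterated_base V E M v k b \<and> unmatched V M b)"

end

theory Submission
  imports Defs
begin

text \<open>The structure of minimum-length alternating paths is read off from a dual certificate. For a
  bound \<open>N\<close> not exceeding the minimum augmenting length, the even and odd levels define vertex
  potentials (the dual variables of a Hungarian search at time \<open>N / 2\<close>), and for each \<open>s < N\<close>
  the map \<open>beta s\<close>, which iterates \<open>base\<close> until the tenacity exceeds \<open>s\<close>, partitions the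
  vertices into blossoms that carry a constant dual weight. If the duals are feasible, summing the edge
  constraints with alternating signs along a path bounds its length from below, and on a minimum path
  to a vertex of tenacity at most \<open>N\<close> the bound is attained; this forces the path to pass through
  each blossom in one contiguous piece that contains the base. In particular the base of every
  vertex of smaller tenacity lies on the path, while on a vertex of tenacity at least that of the
  end point the path is itself of minimum length, so that its base lies on it by definition.

  Feasibility and the independence of the base from the path are established together by induction on \<open>N\<close>.\<close>

section \<open>Alternating paths from unmatched vertices, and their levels\<close>

locale matched_graph =
  fixes V :: "'a set" and E M :: "'a set set"
  assumes finite_graph: "finite_graph V E" and matching: "matching E M"
begin

definition search_path :: "'a list \<Rightarrow> bool" where
  "search_path p \<longleftrightarrow> p \<noteq> [] \<and> distinct p \<and> set p \<subseteq> V \<and> unmatched V M (p ! 0) \<and>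
     (\<forall>i. Suc i < length p \<longrightarrow>
        {p ! i, p ! Suc i} \<in> E \<and> ({p ! i, p ! Suc i} \<in> M \<longleftrightarrow> odd i))"

text \<open>The Boolean argument tells whether the level is the even one.\<close>

definition level :: "bool \<Rightarrow> 'a \<Rightarrow> enat" where
  "level c v = Inf {enat (length p - 1) | p. search_path p \<and> last p = v \<and> even (length p - 1) = c}"

definition ten :: "'a \<Rightarrow> enat" where
  "ten v = level True v + level False v"

text \<open>The parity is that of the path itself, so evenlevel and oddlevel paths are treated as
  one notion.\<close>

definition min_path :: "'a \<Rightarrow> 'a list \<Rightarrow> bool" where
  "min_path v p \<longleftrightarrow> search_path p \<and> last p = v \<and>
     enat (length p - 1) = level (even (length p - 1)) v"

lemma matched_unique: "{x, y} \<in> M \<Longrightarrow> {x, z} \<in> M \<Longrightarrow> y = z"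
  using matching unfolding matching_def by (metis doubleton_eq_iff insertI1 disjoint_iff)

lemma edge_distinct: "{x, y} \<in> E \<Longrightarrow> x \<noteq> y"
  using finite_graph unfolding finite_graph_def by fastforce

lemma edge_in_V: "{x, y} \<in> E \<Longrightarrow> x \<in> V \<and> y \<in> V"
  using finite_graph unfolding finite_graph_def by blast

lemma matched_edge: "{x, y} \<in> M \<Longrightarrow> {x, y} \<in> E"
  using matching unfolding matching_def by blast

lemma matched_not_unmatched: "{x, y} \<in> M \<Longrightarrow> \<not> unmatched V M x"
  unfolding unmatched_def by blast

text \<open>An unmatched start forces edge 0 outside \<open>M\<close>, and alternation propagates
  this, so that the status of every edge is read off from the parity of its index.\<close>

lemma search_path_iff:
  "search_path p \<longleftrightarrow> alternating_path V E M p \<and> unmatched V M (hd p)"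
proof
  assume p: "search_path p"
  then show "alternating_path V E M p \<and> unmatched V M (hd p)"
    unfolding search_path_def alternating_path_def by (simp add: hd_conv_nth)
next
  assume p: "alternating_path V E M p \<and> unmatched V M (hd p)"
  then have u: "unmatched V M (p ! 0)"
    unfolding alternating_path_def by (metis hd_conv_nth)
  have "{p ! i, p ! Suc i} \<in> M \<longleftrightarrow> odd i" if "Suc i < length p" for i
    using that
  proof (induction i)
    case 0
    then show ?case using u matched_not_unmatched by auto
  next
    case (Suc i)
    moreover have "{p ! i, p ! Suc i} \<in> M \<longleftrightarrow> {p ! Suc i, p ! Suc (Suc i)} \<notin> M"
      using p Suc.prems unfolding alternating_path_def by auto
    ultimately show ?case by auto
  qed
  then show "search_path p"
    using p u unfolding search_path_def alternating_path_def by auto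
qed

lemma path_to_iff: "alternating_path_to V E M v p \<longleftrightarrow> search_path p \<and> last p = v"
  unfolding alternating_path_to_def search_path_iff by auto

lemma evenlevel_eq: "evenlevel V E M v = level True v"
  unfolding evenlevel_def level_def path_length_def path_to_iff
  by (rule arg_cong[where f = Inf]) auto

lemma oddlevel_eq: "oddlevel V E M v = level False v"
  unfolding oddlevel_def level_def path_length_def path_to_iff
  by (rule arg_cong[where f = Inf]) auto

lemma tenacity_eq: "tenacity V E M v = ten v"
  unfolding tenacity_def ten_def evenlevel_eq oddlevel_eq ..

lemma min_path_iff: "min_path v p \<longleftrightarrow> evenlevel_path V E M v p \<or> oddlevel_path V E M v p"
  unfolding min_path_def evenlevel_path_def oddlevel_path_def path_to_iff evenlevel_eq oddlevel_eq
    path_length_def by (cases "even (length p - 1)") auto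

lemma search_path_take: "search_path p \<Longrightarrow> i < length p \<Longrightarrow> search_path (take (Suc i) p)"
  unfolding search_path_def by (auto dest: in_set_takeD)

lemma last_take_Suc: "i < length p \<Longrightarrow> last (take (Suc i) p) = p ! i"
  by (simp add: take_Suc_conv_app_nth)

lemma level_le_path: "search_path p \<Longrightarrow> level (even (length p - 1)) (last p) \<le> enat (length p - 1)"
  unfolding level_def by (rule Inf_lower) auto

lemma level_le: "search_path p \<Longrightarrow> i < length p \<Longrightarrow> level (even i) (p ! i) \<le> enat i"
  using level_le_path[OF search_path_take[of p i]] by (simp add: last_take_Suc min_absorb2)

lemma min_path_exists:
  assumes "level c v \<noteq> \<infinity>"
  obtains p where "min_path v p" "even (length p - 1) = c"
proof -
  let ?A = "{enat (length p - 1) | p. search_path p \<and> last p = v \<and> even (length p - 1) = c}"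
  have "?A \<noteq> {}" using assms unfolding level_def Inf_enat_def by (metis (lifting))
  then have "Inf ?A \<in> ?A" unfolding Inf_enat_def by (metis (lifting) LeastI_ex ex_in_conv)
  then obtain p where p: "search_path p" "last p = v" "even (length p - 1) = c"
    "Inf ?A = enat (length p - 1)" by blast
  then have "min_path v p" unfolding min_path_def level_def by simp
  then show ?thesis using that p(3) by blast
qed

lemma min_pathD:
  assumes "min_path v p"
  shows "search_path p" "p \<noteq> []" "distinct p" "length p > 0" "p ! (length p - 1) = v" "last p = v"
    "level (even (length p - 1)) v = enat (length p - 1)"
  using assms unfolding min_path_def search_path_def by (auto simp: last_conv_nth)

lemma min_path_take:
  assumes "search_path p" "i < length p" "level (even i) (p ! i) = enat i"
  shows "min_path (p ! i) (take (Suc i) p)"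
  using assms search_path_take[of p i] unfolding min_path_def
  by (simp add: last_take_Suc min_absorb2)

text \<open>Composite paths are given as functions on indices rather than as lists, which turns the
  splicing lemmas into index arithmetic.\<close>

lemma level_le_walk:
  assumes "inj_on f {..n}" "\<And>i. i \<le> n \<Longrightarrow> f i \<in> V" "unmatched V M (f 0)"
    "\<And>i. i < n \<Longrightarrow> {f i, f (Suc i)} \<in> E \<and> ({f i, f (Suc i)} \<in> M \<longleftrightarrow> odd i)"
  shows "level (even n) (f n) \<le> enat n"
proof -
  let ?p = "map f [0..<Suc n]"
  have "search_path ?p"
    unfolding search_path_def
  proof (intro conjI allI impI)
    show "distinct ?p" using assms(1)
      by (simp only: distinct_map) (auto simp: atLeast0LessThan lessThan_Suc_atMost simp del: upt_Suc)
    show "unmatched V M (?p ! 0)" using assms(3) by (simp del: upt_Suc)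
  qed (use assms(2,4) in \<open>auto simp del: upt_Suc\<close>)
  from level_le[OF this, of n] show ?thesis by (simp del: upt_Suc)
qed

lemma search_pathD:
  assumes "search_path p"
  shows "p \<noteq> []" "distinct p" "unmatched V M (p ! 0)" "\<And>i. i < length p \<Longrightarrow> p ! i \<in> V"
    "\<And>i. Suc i < length p \<Longrightarrow> {p ! i, p ! Suc i} \<in> E"
    "\<And>i. Suc i < length p \<Longrightarrow> {p ! i, p ! Suc i} \<in> M \<longleftrightarrow> odd i"
  using assms unfolding search_path_def by auto

section \<open>Splicing two alternating paths\<close>

text \<open>Follow \<open>q\<close> up to the common vertex, then \<open>p\<close> to its end. Equal
  parities keep the alternation intact at the junction, and \<open>disj\<close> keeps the result
  simple.\<close>

lemma splice_forward:
  assumes p: "search_path p" and q: "search_path q" and i: "i < length p" and j: "j < length q"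
    and eq: "p ! i = q ! j" and par: "even i = even j"
    and disj: "\<And>a. a < j \<Longrightarrow> q ! a \<notin> set (drop i p)"
  shows "level (even (length p - 1)) (last p) \<le> enat (j + (length p - 1 - i))"
proof -
  define n where "n = j + (length p - 1 - i)"
  define f where "f a = (if a < j then q ! a else p ! (a + i - j))" for a
  have cross: "q ! a \<noteq> p ! (b + i - j)" if "a < j" "j \<le> b" "b \<le> n" for a b
  proof -
    have "p ! (b + i - j) \<in> set (drop i p)"
      using that i unfolding n_def in_set_conv_nth by (intro exI[of _ "b - j"]) (auto simp: add.commute)
    then show ?thesis using disj that by metis
  qed
  have fj: "f a = q ! a" if "a \<le> j" for a
    using that eq unfolding f_def by (cases "a = j") auto
  have inj: "inj_on f {..n}"
  proof (rule inj_onI)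
    fix a b assume ab: "a \<in> {..n}" "b \<in> {..n}" "f a = f b"
    show "a = b"
    proof (cases "a < j"; cases "b < j")
      assume "a < j" "b < j"
      then show ?thesis using ab search_pathD(2)[OF q] j unfolding f_def by (simp add: nth_eq_iff_index_eq)
    next
      assume "\<not> a < j" "\<not> b < j"
      then show ?thesis using ab search_pathD(2)[OF p] i unfolding f_def n_def
        by (simp add: nth_eq_iff_index_eq) 
    qed (use ab cross[of a b] cross[of b a] in \<open>auto simp: f_def\<close>)
  qed
  have "level (even n) (f n) \<le> enat n"
  proof (rule level_le_walk[OF inj])
    show "f a \<in> V" if "a \<le> n" for a
      using that search_pathD(4)[OF p, of "a + i - j"] search_pathD(4)[OF q, of a] i j
      unfolding f_def n_def by auto
    show "unmatched V M (f 0)" using fj[of 0] search_pathD(3)[OF q] by simp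
    show "{f a, f (Suc a)} \<in> E \<and> ({f a, f (Suc a)} \<in> M \<longleftrightarrow> odd a)" if "a < n" for a
    proof (cases "a < j")
      case True
      then show ?thesis using fj[of a] fj[of "Suc a"] search_pathD(5,6)[OF q, of a] j by auto
    next
      case False
      then have "f a = p ! (a + i - j)" "f (Suc a) = p ! Suc (a + i - j)" "odd (a + i - j) = odd a"
        "Suc (a + i - j) < length p"
        using that par i unfolding f_def n_def by (auto simp: Suc_diff_le)
      then show ?thesis using search_pathD(5,6)[OF p, of "a + i - j"] by simp
    qed
  qed
  moreover have "\<not> n < j" "n + i - j = length p - 1" using i unfolding n_def by auto
  then have "f n = last p" using search_pathD(1)[OF p] unfolding f_def by (simp add: last_conv_nth)
  moreover have "even n = even (length p - 1)" using par i unfolding n_def by auto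
  ultimately show ?thesis unfolding n_def by simp
qed

text \<open>Follow \<open>q\<close> up to the common vertex, then \<open>p\<close> backwards to
  position \<open>h\<close>. Opposite parities make the reversed edges alternate, and
  \<open>p ! h\<close> is reached with the parity opposite to \<open>h\<close>.\<close>

lemma splice_backward:
  assumes p: "search_path p" and q: "search_path q" and i: "i < length p" and j: "j < length q"
    and h: "h \<le> i" and eq: "p ! i = q ! j" and par: "even i \<noteq> even j"
    and disj: "\<And>a. a < j \<Longrightarrow> q ! a \<notin> set (drop h p)"
  shows "level (odd h) (p ! h) \<le> enat (j + (i - h))"
proof -
  define n where "n = j + (i - h)"
  define f where "f a = (if a < j then q ! a else p ! (i + j - a))" for a
  have cross: "q ! a \<noteq> p ! (i + j - b)" if "a < j" "j \<le> b" "b \<le> n" for a b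
  proof -
    have "p ! (i + j - b) \<in> set (drop h p)"
      using that i h unfolding n_def in_set_conv_nth by (intro exI[of _ "i + j - b - h"]) auto
    then show ?thesis using disj that by metis
  qed
  have fj: "f a = q ! a" if "a \<le> j" for a
    using that eq unfolding f_def by (cases "a = j") auto
  have inj: "inj_on f {..n}"
  proof (rule inj_onI)
    fix a b assume ab: "a \<in> {..n}" "b \<in> {..n}" "f a = f b"
    show "a = b"
    proof (cases "a < j"; cases "b < j")
      assume "a < j" "b < j"
      then show ?thesis using ab search_pathD(2)[OF q] j unfolding f_def by (simp add: nth_eq_iff_index_eq)
    next
      assume "\<not> a < j" "\<not> b < j"
      then show ?thesis using ab search_pathD(2)[OF p] i h unfolding f_def n_def
        by (simp add: nth_eq_iff_index_eq) 
    qed (use ab cross[of a b] cross[of b a] in \<open>auto simp: f_def\<close>)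
  qed
  have "level (even n) (f n) \<le> enat n"
  proof (rule level_le_walk[OF inj])
    show "f a \<in> V" if "a \<le> n" for a
      using that search_pathD(4)[OF p, of "i + j - a"] search_pathD(4)[OF q, of a] i j
      unfolding f_def n_def by auto
    show "unmatched V M (f 0)" using fj[of 0] search_pathD(3)[OF q] by simp
    show "{f a, f (Suc a)} \<in> E \<and> ({f a, f (Suc a)} \<in> M \<longleftrightarrow> odd a)" if "a < n" for a
    proof (cases "a < j")
      case True
      then show ?thesis using fj[of a] fj[of "Suc a"] search_pathD(5,6)[OF q, of a] j by auto
    next
      case False
      define c where "c = i + j - Suc a"
      have c: "i + j - a = Suc c" "Suc c < length p" "i + j = Suc (c + a)"
        using that False i h unfolding n_def c_def by auto
      then have "f a = p ! Suc c" "f (Suc a) = p ! c" 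
        using False unfolding f_def c_def by auto
      moreover have "odd c = odd a" using c(3) par by (metis even_Suc even_add)
      ultimately show ?thesis using search_pathD(5,6)[OF p, of c] c(2) by (simp add: insert_commute)
    qed
  qed
  moreover from h have "\<not> n < j" "i + j - n = h" using h unfolding n_def by auto
  then have "f n = p ! h" unfolding f_def by simp
  moreover have "even n = odd h" using par h unfolding n_def by auto
  ultimately show ?thesis unfolding n_def by simp
qed

text \<open>Follow all of \<open>q\<close>, cross the unmatched edge to the end of \<open>p\<close>
  and walk back to position \<open>h\<close>. The summand \<open>length q\<close> counts the edges
  of \<open>q\<close> and the crossing edge.\<close>

lemma splice_edge:
  assumes p: "search_path p" and q: "search_path q" and h: "h < length p"
    and ev: "odd (length p)" "odd (length q)"
    and e: "{last q, last p} \<in> E" "{last q, last p} \<notin> M"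
    and disj: "set q \<inter> set (drop h p) = {}"
  shows "level (odd h) (p ! h) \<le> enat (length q + (length p - 1 - h))"
proof -
  define l where "l = length p - 1"
  define j where "j = length q"
  define n where "n = j + (l - h)"
  define f where "f a = (if a < j then q ! a else p ! (l + j - a))" for a
  have l: "length p = Suc l" "h \<le> l" and j: "j > 0" "odd j" "even l"
    using h ev search_pathD(1)[OF q] unfolding l_def j_def by auto
  have cross: "q ! a \<noteq> p ! (l + j - b)" if "a < j" "j \<le> b" "b \<le> n" for a b
  proof -
    have "p ! (l + j - b) \<in> set (drop h p)"
      using that l unfolding n_def in_set_conv_nth by (intro exI[of _ "l + j - b - h"]) auto
    moreover have "q ! a \<in> set q" using that unfolding j_def by simp
    ultimately show ?thesis using disj by (metis disjoint_iff)
  qed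
  have inj: "inj_on f {..n}"
  proof (rule inj_onI)
    fix a b assume ab: "a \<in> {..n}" "b \<in> {..n}" "f a = f b"
    show "a = b"
    proof (cases "a < j"; cases "b < j")
      assume "a < j" "b < j"
      then show ?thesis using ab search_pathD(2)[OF q] unfolding f_def j_def by (simp add: nth_eq_iff_index_eq)
    next
      assume "\<not> a < j" "\<not> b < j"
      then show ?thesis using ab search_pathD(2)[OF p] l unfolding f_def n_def
        by (simp add: nth_eq_iff_index_eq) 
    qed (use ab cross[of a b] cross[of b a] in \<open>auto simp: f_def\<close>)
  qed
  have "level (even n) (f n) \<le> enat n"
  proof (rule level_le_walk[OF inj])
    show "f a \<in> V" if "a \<le> n" for a
      using that search_pathD(4)[OF p, of "l + j - a"] search_pathD(4)[OF q, of a] l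
      unfolding f_def n_def j_def by auto
    show "unmatched V M (f 0)" using j search_pathD(3)[OF q] unfolding f_def by simp
    show "{f a, f (Suc a)} \<in> E \<and> ({f a, f (Suc a)} \<in> M \<longleftrightarrow> odd a)" if "a < n" for a
    proof -
      consider "Suc a < j" | "Suc a = j" | "a \<ge> j" by linarith
      then show ?thesis
      proof cases
        case 1
        then show ?thesis using search_pathD(5,6)[OF q, of a] unfolding f_def j_def by auto
      next
        case 2
        then have "f a = last q" "f (Suc a) = last p" "even a"
          using j l search_pathD(1)[OF p] search_pathD(1)[OF q] unfolding f_def
          unfolding j_def by (auto simp: last_conv_nth simp flip: 2[unfolded j_def])
        then show ?thesis using e by simp
      next
        case 3
        define c where "c = l + j - Suc a"
        have c: "l + j - a = Suc c" "Suc c < length p" "l + j = Suc (c + a)"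
          using that 3 l unfolding n_def c_def by auto
        then have "f a = p ! Suc c" "f (Suc a) = p ! c" 
          using 3 unfolding f_def c_def by auto
        moreover have "odd c = odd a" using c(3) j by (metis even_Suc even_add)
        ultimately show ?thesis using search_pathD(5,6)[OF p, of c] c(2) by (simp add: insert_commute)
      qed
    qed
  qed
  moreover have "\<not> n < j" "l + j - n = h" using l unfolding n_def by auto
  then have "f n = p ! h" unfolding f_def by simp
  moreover have "even n = odd h" using j l unfolding n_def by auto
  ultimately show ?thesis unfolding n_def j_def l_def by simp
qed

lemma search_path_snoc:
  assumes "search_path q" "{last q, y} \<in> E" "{last q, y} \<in> M \<longleftrightarrow> even (length q)" "y \<notin> set q"
  shows "search_path (q @ [y])"
proof -
  have q: "q \<noteq> []" "last q = q ! (length q - 1)"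
    using search_pathD(1)[OF assms(1)] by (auto simp: last_conv_nth)
  have "{(q @ [y]) ! i, (q @ [y]) ! Suc i} \<in> E \<and> ({(q @ [y]) ! i, (q @ [y]) ! Suc i} \<in> M \<longleftrightarrow> odd i)"
    if "Suc i < length (q @ [y])" for i
  proof (cases "Suc i = length q")
    case True
    then have "i = length q - 1" "even (length q) = odd i" by presburger+
    then show ?thesis using True assms(2,3) q by (simp add: nth_append)
  next
    case False
    then show ?thesis using that search_pathD(5,6)[OF assms(1), of i] by (simp add: nth_append)
  qed
  then show ?thesis
    using assms(1,4) q edge_in_V[OF assms(2)] unfolding search_path_def by (auto simp: nth_append)
qed

section \<open>Levels and tenacity across a matched edge\<close>

text \<open>Append \<open>x\<close> to a minimum odd path to \<open>y\<close>. Were \<open>x\<close>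
  already on that path, the matched edge at \<open>x\<close> would be a path edge and
  \<open>y\<close> would be its neighbour there, which parity or the position of \<open>y\<close> at
  the end excludes.\<close>

lemma level_even_mate_le:
  assumes xy: "{x, y} \<in> M"
  shows "level True x \<le> level False y + 1"
proof (cases "level False y = \<infinity>")
  case False
  then obtain q where q: "min_path y q" "even (length q - 1) = False" by (rule min_path_exists)
  note qD = min_pathD[OF q(1)] and sD = search_pathD[OF min_pathD(1)[OF q(1)]]
  have "x \<noteq> y" using xy matched_edge edge_distinct by blast
  have "x \<notin> set q"
  proof
    assume "x \<in> set q"
    then obtain i where i: "i < length q" "q ! i = x" by (auto simp: in_set_conv_nth)
    then have il: "i \<noteq> length q - 1" using qD \<open>x \<noteq> y\<close> by auto
    show False
    proof (cases "odd i")
      case True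
      then have "{x, q ! Suc i} \<in> M" using sD(6)[of i] i il by auto
      then have "q ! Suc i = y" using xy matched_unique by blast
      then have "q ! Suc i = q ! (length q - 1)" using qD(5) by simp
      then have "Suc i = length q - 1"
        using nth_eq_iff_index_eq[OF qD(3), of "Suc i" "length q - 1"] i il by simp
      then show False using True q(2) by (metis even_Suc)
    next
      case False
      have "i \<noteq> 0" using i sD(3) matched_not_unmatched[OF xy] by metis
      then obtain k where k: "i = Suc k" by (cases i) auto
      then have "{q ! k, x} \<in> M" using False sD(6)[of k] i by auto
      then have "q ! k = y" using xy matched_unique by (metis insert_commute)
      then have "q ! k = q ! (length q - 1)" using qD(5) by simp
      then have "k = length q - 1"
        using nth_eq_iff_index_eq[OF qD(3), of k "length q - 1"] i k by simp
      then show False using k i by simp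
    qed
  qed
  then have "search_path (q @ [x])"
    using xy qD q(2) matched_edge by (intro search_path_snoc) (auto simp: insert_commute)
  from level_le_path[OF this] qD q(2) show ?thesis
    by (cases "length q") (auto simp: one_enat_def)
qed simp

text \<open>An even path to the matched vertex \<open>x\<close> is nonempty and ends with the
  matched edge at \<open>x\<close>, so its last but one vertex is \<open>y\<close>.\<close>

lemma level_odd_mate_le:
  assumes xy: "{x, y} \<in> M"
  shows "level False y + 1 \<le> level True x"
proof (cases "level True x = \<infinity>")
  case False
  then obtain p where p: "min_path x p" "even (length p - 1) = True" by (rule min_path_exists)
  note pD = min_pathD[OF p(1)] and sD = search_pathD[OF min_pathD(1)[OF p(1)]]
  have "length p - 1 \<noteq> 0" using pD(5) sD(3) matched_not_unmatched[OF xy] by metis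
  then obtain k where k: "length p = Suc (Suc k)" "odd k" using p(2) 
    by (cases "length p"; cases "length p - 1") auto
  then have "{p ! k, x} \<in> M" using sD(6)[of k] pD(5) by auto
  then have "p ! k = y" using xy matched_unique by (metis insert_commute)
  then have "level False y \<le> enat k" using level_le[OF pD(1), of k] k by simp
  then show ?thesis using pD(7) p(2) k by (cases "level False y") (auto simp: one_enat_def)
qed simp

lemma level_mate: "{x, y} \<in> M \<Longrightarrow> level True x = level False y + 1"
  using level_even_mate_le level_odd_mate_le by (simp add: order_antisym)

lemma ten_mate: "{x, y} \<in> M \<Longrightarrow> ten x = ten y"
  using level_mate[of x y] level_mate[of y x] unfolding ten_def by (simp add: insert_commute ac_simps)

lemma ten_eq_levels: "ten v = level c v + level (\<not> c) v"
  unfolding ten_def by (cases c) (auto simp: ac_simps)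

lemma level_finite: "ten v \<noteq> \<infinity> \<Longrightarrow> level c v \<noteq> \<infinity>"
  unfolding ten_eq_levels[of v c] by (metis plus_enat_simps(2))

section \<open>Prefixes of minimum paths\<close>

text \<open>Take the first vertex of \<open>q\<close> on the part of \<open>p\<close> from
  \<open>i\<close> on. If the parities agree, \<open>q\<close> continues along \<open>p\<close> to
  \<open>v\<close>, and minimality of \<open>p\<close> gives \<open>k \<le> j\<close>; otherwise
  \<open>q\<close> turns back along \<open>p\<close> to \<open>p ! i\<close>.\<close>

lemma first_meeting:
  assumes p: "min_path v p" and i: "i < length p" and q: "search_path q"
    and a: "a < length q" "q ! a \<in> set (drop i p)"
  obtains j k where "j \<le> a" "i \<le> k" "k < length p" "q ! j = p ! k"
    "\<And>j'. j' < j \<Longrightarrow> q ! j' \<notin> set (drop i p)" "even j = even k" "k \<le> j"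
  | j k where "j \<le> a" "i \<le> k" "k < length p" "q ! j = p ! k"
    "\<And>j'. j' < j \<Longrightarrow> q ! j' \<notin> set (drop i p)" "even j \<noteq> even k"
    "level (odd i) (p ! i) \<le> enat (j + (k - i))"
proof -
  define j where "j = (LEAST j. q ! j \<in> set (drop i p))"
  have j: "q ! j \<in> set (drop i p)" "j \<le> a" "\<And>j'. j' < j \<Longrightarrow> q ! j' \<notin> set (drop i p)"
    using a(2) unfolding j_def by (auto intro: LeastI Least_le dest: not_less_Least)
  then obtain k0 where "k0 < length (drop i p)" "drop i p ! k0 = q ! j" by (metis in_set_conv_nth)
  then obtain k where k: "i \<le> k" "k < length p" "q ! j = p ! k"
    using i by (intro that[of "i + k0"]) auto
  have sub: "set (drop k p) \<subseteq> set (drop i p)" using k(1) by (rule set_drop_subset_set_drop)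
  note pD = min_pathD[OF p]
  show ?thesis
  proof (cases "even j = even k")
    case True
    have "level (even (length p - 1)) (last p) \<le> enat (j + (length p - 1 - k))"
      using j k a sub True by (intro splice_forward[OF pD(1) q]) auto
    then have "k \<le> j" using pD k by simp
    then show ?thesis using that(1) j k True by blast
  next
    case False
    have "level (odd i) (p ! i) \<le> enat (j + (k - i))"
      using j k a False by (intro splice_backward[OF pD(1) q]) auto
    then show ?thesis using that(2) j k False by blast
  qed
qed

lemma last_in_drop: "i < length p \<Longrightarrow> last p \<in> set (drop i p)"
  by (metis drop_eq_Nil last_drop last_in_set not_le)

text \<open>If \<open>u\<close> had a shorter path, follow first a minimum path to \<open>v\<close> of the other parity and then that
  shorter path until they meet the part of \<open>p\<close> after \<open>u\<close>: each time either \<open>p\<close> can be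
  shortened or \<open>u\<close> is reached backwards with the other parity, which bounds its tenacity.\<close>

lemma level_on_min_path:
  assumes p: "min_path v p" and fin: "ten v \<noteq> \<infinity>" and i: "i < length p" and ge: "ten v \<le> ten (p ! i)"
  shows "level (even i) (p ! i) = enat i"
proof (rule ccontr)
  assume "level (even i) (p ! i) \<noteq> enat i"
  moreover have "level (even i) (p ! i) \<le> enat i" using level_le min_pathD(1)[OF p] i by blast
  ultimately have lt: "level (even i) (p ! i) < enat i" by simp
  then have "level (even i) (p ! i) \<noteq> \<infinity>" by (metis enat_ord_simps(6))
  then obtain q where q: "min_path (p ! i) q" "even (length q - 1) = even i" by (rule min_path_exists)
  obtain r where r: "min_path v r" "even (length r - 1) = odd (length p - 1)"
    using level_finite[OF fin] by (rule min_path_exists)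
  note pD = min_pathD[OF p] and qD = min_pathD[OF q(1)] and rD = min_pathD[OF r(1)]
  define L m a where "L = length p - 1" and "m = length r - 1" and "a = length q - 1"
  have ai: "a < i" using lt qD(7) q(2) unfolding a_def by simp
  have tv: "ten v = enat (L + m)"
    using ten_eq_levels[of v "even L"] pD(7) rD(7) r(2) unfolding L_def m_def by simp
  have tu: "ten (p ! i) = enat a + level (odd i) (p ! i)"
    using ten_eq_levels[of "p ! i" "even i"] qD(7) q(2) unfolding a_def by simp
  have "last p \<in> set (drop i p)" using i by (rule last_in_drop)
  then have "m < length r" "r ! m \<in> set (drop i p)"
    using rD pD unfolding m_def by auto
  \<comment> \<open>Case 2 would bound the tenacity of \<open>p ! i\<close> by
    \<open>a + j + (k - i)\<close>, which is below \<open>L + m\<close> because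
    \<open>a < i\<close>. For \<open>q\<close> below, where \<open>j \<le> a\<close>, the same bound
    only yields \<open>m < a\<close>, while case 1 contradicts \<open>a < i\<close>.\<close>
  with p i rD(1) have "i \<le> m"
  proof (cases rule: first_meeting)
    case (2 j k)
    then have "ten (p ! i) \<le> enat (a + (j + (k - i)))"
      unfolding tu by (metis add_left_mono plus_enat_simps(1))
    then have "enat (L + m) \<le> enat (a + (j + (k - i)))" using ge tv by (metis order_trans)
    then show ?thesis using 2 ai unfolding L_def by simp
  qed linarith
  moreover have "a < length q" "q ! a \<in> set (drop i p)"
    using qD i unfolding a_def by (auto simp: in_set_conv_nth intro!: exI[of _ 0])
  with p i qD(1) have "m < a"
  proof (cases rule: first_meeting)
    case (2 j k)
    then have "ten (p ! i) \<le> enat (a + (j + (k - i)))"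
      unfolding tu by (metis add_left_mono plus_enat_simps(1))
    then have "enat (L + m) \<le> enat (a + (j + (k - i)))" using ge tv by (metis order_trans)
    then show ?thesis using 2 ai unfolding L_def by simp
  qed (use ai in linarith)
  ultimately show False using ai by simp
qed

lemma min_path_prefix:
  assumes "min_path v p" "ten v \<noteq> \<infinity>" "i < length p" "ten v \<le> ten (p ! i)"
  shows "min_path (p ! i) (take (Suc i) p)"
  using assms level_on_min_path min_path_take min_pathD(1) by blast

section \<open>Bases and their iteration up to a tenacity bound\<close>

definition min_aug :: enat where "min_aug = min_augmenting_length V E M"

lemma level_True_unmatched: "unmatched V M f \<Longrightarrow> level True f = 0"
proof -
  assume "unmatched V M f"
  then have "search_path [f]" unfolding search_path_def unmatched_def by auto
  from level_le_path[OF this] show ?thesis by (simp add: zero_enat_def[symmetric])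
qed

text \<open>An odd path ending at an unmatched vertex has distinct ends, hence is
  augmenting.\<close>

lemma ten_unmatched:
  assumes f: "unmatched V M f"
  shows "min_aug \<le> ten f"
proof -
  have "min_aug \<le> level False f" unfolding level_def
  proof (rule Inf_greatest)
    fix x assume "x \<in> {enat (length p - 1) | p. search_path p \<and> last p = f \<and> even (length p - 1) = False}"
    then obtain p where p: "x = enat (length p - 1)" "search_path p" "last p = f" "odd (length p - 1)" by auto
    have "length p - 1 \<noteq> 0" using p(4) by (metis even_zero)
    then have "hd p \<noteq> last p" using search_pathD(1,2)[OF p(2)]
      by (simp add: hd_conv_nth last_conv_nth nth_eq_iff_index_eq)
    then have "augmenting_path V E M p" using p f unfolding augmenting_path_def search_path_iff by auto
    then show "min_aug \<le> x" unfolding min_aug_def min_augmenting_length_def p(1) path_length_def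
      by (intro Inf_lower) auto
  qed
  then show ?thesis unfolding ten_def level_True_unmatched[OF f] by simp
qed

definition last_above :: "enat \<Rightarrow> 'a list \<Rightarrow> nat \<Rightarrow> bool" where
  "last_above N p i \<longleftrightarrow> i < length p \<and> N < ten (p ! i) \<and> (\<forall>j < length p. N < ten (p ! j) \<longrightarrow> j \<le> i)"

text \<open>Says that the definite description in \<open>base\<close> denotes the intended vertex on
  every minimum path; until this is established nothing is known about \<open>base\<close>.\<close>

definition well_based :: "'a \<Rightarrow> bool" where
  "well_based v \<longleftrightarrow> (\<forall>p. min_path v p \<longrightarrow> (\<exists>i. last_above (ten v) p i \<and> p ! i = base V E M v))"

definition based_below :: "nat \<Rightarrow> bool" where
  "based_below N \<longleftrightarrow> (\<forall>v. ten v < enat N \<longrightarrow> well_based v)"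

lemma last_above_unique: "last_above N p i \<Longrightarrow> last_above N p j \<Longrightarrow> i = j"
  unfolding last_above_def by (auto intro!: order_antisym)

lemma last_above_exists:
  assumes "search_path p" "N < min_aug"
  obtains i where "last_above N p i"
proof -
  let ?A = "{j. j < length p \<and> N < ten (p ! j)}"
  have "N < ten (p ! 0)"
    using ten_unmatched[OF search_pathD(3)[OF assms(1)]] assms(2) by (rule order.strict_trans2[rotated])
  then have "0 \<in> ?A" "finite ?A" using search_pathD(1)[OF assms(1)] by auto
  then have "Max ?A \<in> ?A" "\<forall>j\<in>?A. j \<le> Max ?A" using Max_in[of ?A] Max_ge[of ?A] by blast+
  then show ?thesis using that[of "Max ?A"] unfolding last_above_def by blast
qed

lemma last_above_take:
  assumes "last_above N p i" "i < k" "k < length p"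
  shows "last_above N (take (Suc k) p) i"
  using assms unfolding last_above_def by auto

lemma ten_pos: "0 < ten v"
proof -
  have "level False v \<noteq> 0"
  proof
    assume *: "level False v = 0"
    then have "level False v \<noteq> \<infinity>" by simp
    then obtain p where "min_path v p" "even (length p - 1) = False" by (rule min_path_exists)
    then have "enat (length p - 1) = 0" "odd (length p - 1)"
      using min_pathD(7)[of v p] * by simp_all
    then show False by (metis enat_0_iff(1) even_zero)
  qed
  then show ?thesis unfolding ten_def by simp
qed

text \<open>One test per stage suffices: once the tenacity exceeds \<open>s\<close>, only the value
  \<open>Suc s\<close> fails to exceed \<open>Suc s\<close>, and a well-based vertex has a base of
  strictly higher tenacity.\<close>

primrec beta :: "nat \<Rightarrow> 'a \<Rightarrow> 'a" where
  "beta 0 x = x"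
| "beta (Suc s) x = (if ten (beta s x) = enat (Suc s) then base V E M (beta s x) else beta s x)"

lemma well_based_ten_base:
  assumes "well_based v" "ten v \<noteq> \<infinity>"
  shows "ten v < ten (base V E M v)"
proof -
  obtain p where "min_path v p" "even (length p - 1) = True"
    using level_finite[OF assms(2)] by (rule min_path_exists)
  then show ?thesis using assms(1) unfolding well_based_def last_above_def by metis
qed

lemma enat_Suc_cases: "enat s < t \<Longrightarrow> t \<noteq> enat (Suc s) \<Longrightarrow> enat (Suc s) < t"
  by (cases t) auto

lemma ten_beta: "based_below N \<Longrightarrow> s < N \<Longrightarrow> enat s < ten (beta s x)"
proof (induction s)
  case 0
  then show ?case using ten_pos by (simp add: zero_enat_def)
next
  case (Suc s)
  then have IH: "enat s < ten (beta s x)" by simp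
  show ?case
  proof (cases "ten (beta s x) = enat (Suc s)")
    case True
    then have "well_based (beta s x)" using Suc.prems unfolding based_below_def by simp
    from well_based_ten_base[OF this] True show ?thesis by simp
  next
    case False
    then show ?thesis using enat_Suc_cases[OF IH] by simp
  qed
qed

lemma beta_eq_self: "enat s < ten x \<Longrightarrow> beta s x = x"
proof (induction s)
  case (Suc s)
  then have "enat s < ten x" by (metis enat_ord_simps(2) lessI less_trans)
  then show ?case using Suc by auto
qed simp

text \<open>Each stage depends only on the value of the previous one, so the partitions coarsen as
  \<open>s\<close> grows: the blossoms are nested.\<close>

lemma beta_eq_mono: "beta s x = beta s y \<Longrightarrow> s \<le> s' \<Longrightarrow> beta s' x = beta s' y"
  by (rotate_tac 1, induction rule: dec_induct) auto

lemma beta_at_tenacity: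
  assumes "ten x = enat n"
  shows "beta n x = base V E M x"
proof (cases n)
  case 0
  then show ?thesis using assms ten_pos[of x] by (simp add: zero_enat_def)
next
  case (Suc m)
  then show ?thesis using assms beta_eq_self[of m x] by simp
qed

text \<open>A minimum even path to \<open>x\<close> ends with the edge from \<open>y\<close>, and
  without that edge it is a minimum odd path to \<open>y\<close>. Both ends have the same tenacity,
  so the last vertex above it is the same for both.\<close>

lemma base_mate:
  assumes xy: "{x, y} \<in> M" and wb: "well_based x" "well_based y" and fin: "ten x \<noteq> \<infinity>"
  shows "base V E M x = base V E M y"
proof -
  have ty: "ten y = ten x" using ten_mate[OF xy] by simp
  then have "level False y \<noteq> \<infinity>" using fin level_finite by metis
  then obtain q where q: "min_path y q" "even (length q - 1) = False" by (rule min_path_exists)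
  note qD = min_pathD[OF q(1)]
  have "level True x \<noteq> \<infinity>" using fin level_finite by metis
  then obtain p where p: "min_path x p" "even (length p - 1) = True" by (rule min_path_exists)
  note pD = min_pathD[OF p(1)] and sD = search_pathD[OF min_pathD(1)[OF p(1)]]
  have "length p - 1 \<noteq> 0" using pD(5) sD(3) matched_not_unmatched[OF xy] by metis
  then obtain k where k: "length p = Suc (Suc k)" "odd k" using p(2) 
    by (cases "length p"; cases "length p - 1") auto
  then have "{p ! k, x} \<in> M" using sD(6)[of k] pD(5) by auto
  then have pk: "p ! k = y" using xy matched_unique by (metis insert_commute)
  have "level False y + 1 = enat (Suc k)" using level_mate[OF xy] pD(7) p(2) k by simp
  then have "level False y = enat k" by (cases "level False y") (auto simp: one_enat_def)
  then have "min_path y (take (Suc k) p)" using min_path_take[OF pD(1), of k] k pk by simp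
  then obtain i where i: "last_above (ten y) (take (Suc k) p) i" "take (Suc k) p ! i = base V E M y"
    using wb(2) unfolding well_based_def by blast
  obtain j where j: "last_above (ten x) p j" "p ! j = base V E M x"
    using wb(1) p(1) unfolding well_based_def by blast
  have "j \<noteq> Suc k" "j \<noteq> k" using j pD(5) k pk ty unfolding last_above_def by auto
  then have "j < k" using j k unfolding last_above_def by auto
  then have "last_above (ten y) (take (Suc k) p) j" using last_above_take[OF j(1), of k] k ty by simp
  then have "i = j" using i(1) last_above_unique by blast
  then show ?thesis using i j \<open>j < k\<close> by simp
qed

lemma beta_mate:
  assumes "based_below N" "s < N" "{x, y} \<in> M" "ten x \<le> enat s"
  shows "beta s x = beta s y"
proof -
  obtain n where n: "ten x = enat n" using assms(4) by (cases "ten x") auto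
  moreover have "ten y = enat n" using n ten_mate[OF assms(3)] by simp
  moreover have "well_based x" "well_based y"
    using assms n calculation unfolding based_below_def by auto
  ultimately have "beta n x = beta n y" using base_mate[OF assms(3)] by (simp add: beta_at_tenacity)
  then show ?thesis using beta_eq_mono[of n x y s] n assms(4) by simp
qed

section \<open>Counting edges inside blossoms along a path\<close>

text \<open>The number of matched minus the number of unmatched edges among the first \<open>i\<close> edges of \<open>p\<close>
  that lie inside a blossom of level \<open>s\<close>. Its correction \<open>slack\<close> is nondecreasing along the path; it grows
  exactly when a blossom is left without having visited its base, or entered after its base
  was visited.\<close>

definition excess :: "nat \<Rightarrow> 'a list \<Rightarrow> nat \<Rightarrow> int" where
  "excess s p i = (\<Sum>j<i. if beta s (p ! j) = beta s (p ! Suc j) then (if even j then -1 else 1) else 0)"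

definition slack :: "nat \<Rightarrow> 'a list \<Rightarrow> nat \<Rightarrow> int" where
  "slack s p i =
     (if even i then excess s p i - of_bool (beta s (p ! i) \<notin> set (take (Suc i) p))
      else excess s p i + of_bool (beta s (p ! i) \<in> set (take i p)))"

text \<open>The equality case of the counting: a blossom is left only after its base was visited,
  and entered only before.\<close>

definition tight :: "nat \<Rightarrow> 'a list \<Rightarrow> bool" where
  "tight s p \<longleftrightarrow> beta s (last p) \<in> set p \<and>
     (\<forall>i. Suc i < length p \<longrightarrow> beta s (p ! i) \<noteq> beta s (p ! Suc i) \<longrightarrow>
        beta s (p ! i) \<in> set (take (Suc i) p) \<and> beta s (p ! Suc i) \<notin> set (take (Suc i) p))"

lemma nth_notin_take: "distinct p \<Longrightarrow> i < length p \<Longrightarrow> p ! i \<notin> set (take i p)"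
  by (auto simp: in_set_conv_nth nth_eq_iff_index_eq)

lemma set_take_Suc: "i < length p \<Longrightarrow> set (take (Suc i) p) = insert (p ! i) (set (take i p))"
  by (simp add: take_Suc_conv_app_nth)

text \<open>For an unmatched edge inside a blossom, the change of correction offsets the lost unit.
  A matched edge is inside a blossom exactly if its ends have tenacity at most \<open>s\<close>, and
  then neither end is the base; otherwise each end is its own \<open>beta s\<close>.\<close>

lemma slack_Suc:
  assumes bb: "based_below N" "s < N" and p: "search_path p" and i: "Suc i < length p"
  shows "slack s p (Suc i) = slack s p i +
    (if beta s (p ! i) = beta s (p ! Suc i) then 0
     else of_bool (beta s (p ! i) \<notin> set (take (Suc i) p)) +
          of_bool (beta s (p ! Suc i) \<in> set (take (Suc i) p)))"
proof (cases "even i")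
  case True
  then show ?thesis unfolding slack_def excess_def by auto
next
  case False
  note pD = search_pathD[OF p]
  have M: "{p ! i, p ! Suc i} \<in> M" using pD(6)[of i] False i by auto
  have t: "ten (p ! i) = ten (p ! Suc i)" using ten_mate[OF M] .
  have notin: "p ! i \<notin> set (take i p)" "p ! Suc i \<notin> set (take (Suc i) p)"
    using nth_notin_take[OF pD(2)] i by auto
  have sets: "set (take (Suc i) p) = insert (p ! i) (set (take i p))"
    "set (take (Suc (Suc i)) p) = insert (p ! Suc i) (insert (p ! i) (set (take i p)))"
    using i by (auto simp: set_take_Suc)
  have ne: "p ! i \<noteq> p ! Suc i" using notin sets by auto
  show ?thesis
  proof (cases "ten (p ! i) \<le> enat s")
    case True
    then have eq: "beta s (p ! i) = beta s (p ! Suc i)" using beta_mate[OF bb M] by simp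
    have "beta s (p ! i) \<noteq> p ! i" "beta s (p ! i) \<noteq> p ! Suc i"
      using ten_beta[OF bb, of "p ! i"] True t by auto
    then show ?thesis using False eq sets unfolding slack_def excess_def by auto
  next
    case nle: False
    then have "beta s (p ! i) = p ! i" "beta s (p ! Suc i) = p ! Suc i"
      using beta_eq_self t by auto
    then show ?thesis using False sets notin ne unfolding slack_def excess_def by auto
  qed
qed

lemma slack_mono:
  assumes bb: "based_below N" "s < N" and p: "search_path p" and ij: "i \<le> j" "j < length p"
  shows "slack s p i \<le> slack s p j"
  using ij
proof (induction j)
  case (Suc j)
  show ?case
  proof (cases "i = Suc j")
    case False
    then have "slack s p i \<le> slack s p j" using Suc by simp
    then show ?thesis using slack_Suc[OF bb p, of j] Suc.prems by auto
  qed simp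
qed simp

lemma slack_0:
  assumes "search_path p" "enat s < min_aug"
  shows "slack s p 0 = 0"
proof -
  have "enat s < ten (p ! 0)"
    using ten_unmatched[OF search_pathD(3)[OF assms(1)]] assms(2) by (rule order.strict_trans2[rotated])
  then show ?thesis using search_pathD(1)[OF assms(1)]
    unfolding slack_def excess_def by (simp add: beta_eq_self set_take_Suc)
qed

text \<open>The slack starts at 0 and never decreases. At an even end it is at most the excess; at
  an odd end it exceeds the excess by at most 1, and only if \<open>beta s\<close> of the end was
  visited before the end, which needs tenacity at most \<open>s\<close>. Equality keeps the slack at
  0 throughout, so no step violates \<open>tight\<close>.\<close>

lemma
  assumes bb: "based_below N" "s < N" and p: "search_path p" and aug: "enat N \<le> min_aug"
  defines "low \<equiv> - of_bool (odd (length p - 1) \<and> ten (last p) \<le> enat s)"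
  shows excess_lower: "low \<le> excess s p (length p - 1)"
    and tight_if_excess_low: "excess s p (length p - 1) \<le> low \<Longrightarrow> tight s p"
proof -
  note pD = search_pathD[OF p]
  define L where "L = length p - 1"
  have L: "length p = Suc L" "last p = p ! L" using pD(1) unfolding L_def by (auto simp: last_conv_nth)
  have "enat s < enat N" using bb(2) by simp
  then have s0: "slack s p 0 = 0" using slack_0[OF p] aug by (metis order.strict_trans2)
  then have sL: "0 \<le> slack s p L" using slack_mono[OF bb p, of 0 L] L by simp
  have b: "beta s (p ! L) \<notin> set (take L p)" if "\<not> ten (p ! L) \<le> enat s"
    using that nth_notin_take[OF pD(2), of L] L by (simp add: beta_eq_self)
  show "low \<le> excess s p (length p - 1)"
    using sL b unfolding low_def L_def[symmetric] slack_def L(2) by (auto simp: of_bool_def split: if_splits)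
  assume ex: "excess s p (length p - 1) \<le> low"
  have sL0: "slack s p L = 0"
    using ex sL b unfolding low_def L_def[symmetric] slack_def L(2) by (auto simp: of_bool_def split: if_splits)
  have bL: "beta s (last p) \<in> set p"
  proof (cases "even L")
    case True
    then show ?thesis using ex sL b L unfolding low_def L_def[symmetric] slack_def by (auto simp: of_bool_def dest: in_set_takeD split: if_splits)
  next
    case False
    show ?thesis
    proof (cases "ten (last p) \<le> enat s")
      case True
      then have "beta s (p ! L) \<in> set (take L p)"
        using ex sL False unfolding low_def L_def[symmetric] slack_def L(2) by (auto simp: of_bool_def split: if_splits)
      then show ?thesis unfolding L(2) by (rule in_set_takeD)
    next
      case False
      then show ?thesis using pD(1) by (simp add: beta_eq_self)
    qed
  qed
  show "tight s p" unfolding tight_def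
  proof (intro conjI allI impI bL)
    fix i assume i: "Suc i < length p" and ne: "beta s (p ! i) \<noteq> beta s (p ! Suc i)"
    have "0 \<le> slack s p i" "slack s p (Suc i) \<le> 0"
      using slack_mono[OF bb p, of 0 i] slack_mono[OF bb p, of "Suc i" L] i L s0 sL0 by auto
    then show "beta s (p ! i) \<in> set (take (Suc i) p)" "beta s (p ! Suc i) \<notin> set (take (Suc i) p)"
      using slack_Suc[OF bb p i] ne by (auto simp: of_bool_def split: if_splits)
  qed
qed

text \<open>Go backwards from the end, whose base is on the path: inside a blossom the base stays
  the same, and at an exit it was already visited.\<close>

lemma tight_beta_mem:
  assumes t: "tight s p" and i: "i < length p"
  shows "beta s (p ! i) \<in> set p"
proof -
  define L where "L = length p - 1"
  have L: "i \<le> L" "length p = Suc L" using i unfolding L_def by auto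
  show ?thesis using L(1)
  proof (induction rule: inc_induct)
    case base
    have "last p = p ! L" using L by (cases p) (auto simp: last_conv_nth)
    then show ?case using t unfolding tight_def by simp
  next
    case (step n)
    show ?case
    proof (cases "beta s (p ! n) = beta s (p ! Suc n)")
      case False
      then have "beta s (p ! n) \<in> set (take (Suc n) p)"
        using t step L unfolding tight_def by auto
      then show ?thesis by (rule in_set_takeD)
    qed (use step in simp)
  qed
qed

lemma nat_change:
  assumes "i \<le> k" "P i" "\<not> P k"
  obtains m :: nat where "i \<le> m" "m < k" "P m" "\<not> P (Suc m)"
  using assms
proof (induction arbitrary: thesis rule: dec_induct)
  case (step n)
  then show ?case by (cases "P n") (auto intro: less_SucI)
qed simp

text \<open>A blossom that was left has its base visited, and one that is entered has not, so no
  blossom is entered again.\<close>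

lemma tight_between:
  assumes t: "tight s p" and k: "i \<le> k" "k \<le> j" "j < length p"
    and eq: "beta s (p ! i) = beta s (p ! j)"
  shows "beta s (p ! k) = beta s (p ! i)"
proof (rule ccontr)
  let ?b = "beta s (p ! i)"
  assume ne: "beta s (p ! k) \<noteq> ?b"
  obtain m where m: "m < k" "beta s (p ! m) = ?b" "beta s (p ! Suc m) \<noteq> ?b"
    using nat_change[of i k "\<lambda>m. beta s (p ! m) = ?b"] k(1) ne by blast
  obtain n where n: "k \<le> n" "n < j" "beta s (p ! n) \<noteq> ?b" "beta s (p ! Suc n) = ?b"
    using nat_change[of k j "\<lambda>m. beta s (p ! m) \<noteq> ?b"] k(2) ne eq by force
  have "Suc m < length p" "Suc n < length p" using m n k by linarith+
  then have "?b \<in> set (take (Suc m) p)" "?b \<notin> set (take (Suc n) p)"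
    using t m n unfolding tight_def by metis+
  moreover have "set (take (Suc m) p) \<subseteq> set (take (Suc n) p)"
    using m(1) n(1) by (intro set_take_subset_set_take) simp
  ultimately show False by blast
qed

section \<open>The dual certificate and its equality case\<close>

text \<open>Scaled by 2, so that time \<open>N / 2\<close> causes no fractions. The three cases are outer, inner and unreached vertices.
  In the first two the level that is used is finite, so that \<open>the_enat\<close> is meaningful.\<close>

definition potential :: "nat \<Rightarrow> 'a \<Rightarrow> int" where
  "potential N x =
    (if ten x < enat N \<or> level True x + level True x < enat N
       then 2 * int (the_enat (level True x)) - int N
     else if level False x + level False x < enat N
       then int N - 2 * int (the_enat (level False x))
     else 0)"

text \<open>The total dual weight of the blossoms containing both \<open>x\<close> and
  \<open>y\<close>, each level below \<open>N\<close> contributing 1.\<close>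

definition shared :: "nat \<Rightarrow> 'a \<Rightarrow> 'a \<Rightarrow> nat" where
  "shared N x y = card {s. s < N \<and> beta s x = beta s y}"

text \<open>Only unmatched edges need a condition here; the reverse inequality for matched edges is
  proved in \<open>potential_matched\<close>.\<close>

definition feasible :: "nat \<Rightarrow> bool" where
  "feasible N \<longleftrightarrow> (\<forall>x y. {x, y} \<in> E \<longrightarrow> {x, y} \<notin> M \<longrightarrow>
     - 2 \<le> potential N x + potential N y + 2 * int (shared N x y))"

text \<open>At the boundary \<open>ten x = enat N\<close> the two levels add up to \<open>N\<close>,
  so the outer and the inner formula agree; this is why equality is allowed here.\<close>

lemma potential_outer:
  assumes "level True x = enat e"
    "ten x \<le> enat N \<or> 2 * e < N"
  shows "potential N x = 2 * int e - int N"
proof (cases "ten x < enat N \<or> 2 * e < N")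
  case True
  then show ?thesis using assms unfolding potential_def by auto
next
  case False
  then have t: "ten x = enat N" "N \<le> 2 * e" using assms(2) by auto
  then obtain oo where "level False x = enat oo" "e + oo = N"
    using assms(1) unfolding ten_def by (cases "level False x") auto
  then show ?thesis using t assms(1) unfolding potential_def by auto
qed

text \<open>If the common tenacity \<open>n\<close> is below \<open>N\<close>, the ends share the
  levels from \<open>n\<close> to \<open>N - 1\<close> and their even levels add up to
  \<open>n + 1\<close>, so the sum is exactly 2. Otherwise they share no level, and each even level
  is one more than the odd level of the partner.\<close>

lemma potential_matched:
  assumes bb: "based_below N" and xy: "{x, y} \<in> M"
  shows "potential N x + potential N y + 2 * int (shared N x y) \<le> 2"
proof (cases "ten x < enat N")
  case True
  then obtain n where n: "ten x = enat n" "n < N" by (cases "ten x") auto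
  have ty: "ten y = enat n" using ten_mate[OF xy] n by simp
  have ne: "x \<noteq> y" using xy matched_edge edge_distinct by blast
  have "{s. s < N \<and> beta s x = beta s y} = {n..<N}"
    using beta_mate[OF bb _ xy] n ty ne beta_eq_self[of _ x] beta_eq_self[of _ y]
    by (auto simp: not_less[symmetric])
  then have "shared N x y = N - n" unfolding shared_def by simp
  moreover obtain e1 e2 where e: "level True x = enat e1" "level True y = enat e2"
    using level_finite[of x True] level_finite[of y True] n ty by auto
  moreover have "e1 + e2 = Suc n"
    using n(1) level_mate[of y x] xy e unfolding ten_def
    by (cases "level False x") (auto simp: insert_commute one_enat_def)
  ultimately show ?thesis using potential_outer[of x e1 N] potential_outer[of y e2 N] n ty by auto
next
  case False
  have ty: "ten y = ten x" using ten_mate[OF xy] by simp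
  have ne: "x \<noteq> y" using xy matched_edge edge_distinct by blast
  have "beta s x \<noteq> beta s y" if "s < N" for s
  proof -
    have "enat s < ten x" using that False by (meson enat_ord_simps(2) leI less_le_trans)
    then show ?thesis using ne ty by (simp add: beta_eq_self)
  qed
  then have "{s. s < N \<and> beta s x = beta s y} = {}" by blast
  then have sh: "shared N x y = 0" unfolding shared_def by simp
  have lm: "level True x = level False y + 1" "level True y = level False x + 1"
    using level_mate[OF xy] level_mate[of y x] xy by (auto simp: insert_commute)
  show ?thesis using False ty lm sh unfolding potential_def ten_def
    by (cases "level False x"; cases "level False y") (auto simp: one_enat_def)
qed

text \<open>Edge constraints are added along the path with alternating signs, so the potentials of
  inner positions cancel and the shared levels add up to the excess. The start has potential
  \<open>- int N\<close>, which the leading \<open>int N\<close> cancels.\<close>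

lemma length_ge_potential:
  assumes bb: "based_below N" and fe: "feasible N" and p: "search_path p" and i: "i < length p"
  shows "int N + (if even i then potential N (p ! i) else - potential N (p ! i))
           + 2 * (\<Sum>s<N. excess s p i) \<le> 2 * int i"
  using i
proof (induction i)
  case 0
  have "level True (p ! 0) = 0" using level_True_unmatched search_pathD(3)[OF p] by blast
  then show ?case by (simp add: excess_def potential_def zero_enat_def)
next
  case (Suc i)
  let ?x = "p ! i" and ?y = "p ! Suc i"
  have IH: "int N + (if even i then potential N ?x else - potential N ?x)
           + 2 * (\<Sum>s<N. excess s p i) \<le> 2 * int i" using Suc by simp
  have "(\<Sum>s<N. excess s p (Suc i)) =
    (\<Sum>s<N. excess s p i) + (\<Sum>s<N. if beta s ?x = beta s ?y then (if even i then -1 else 1) else 0)"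
    unfolding excess_def by (simp add: sum.distrib)
  also have "(\<Sum>s<N. if beta s ?x = beta s ?y then (if even i then -1 else 1) else (0::int)) =
      (\<Sum>s\<in>{s. s < N \<and> beta s ?x = beta s ?y}. if even i then -1 else 1)"
    by (rule sum.mono_neutral_cong_right) auto
  also have "\<dots> = (if even i then - int (shared N ?x ?y) else int (shared N ?x ?y))"
    unfolding shared_def by simp
  finally have ex: "(\<Sum>s<N. excess s p (Suc i)) = (\<Sum>s<N. excess s p i) +
    (if even i then - int (shared N ?x ?y) else int (shared N ?x ?y))" .
  note pD = search_pathD(5,6)[OF p Suc.prems]
  show ?case
  proof (cases "even i")
    case True
    then have "- 2 \<le> potential N ?x + potential N ?y + 2 * int (shared N ?x ?y)"
      using pD fe unfolding feasible_def by blast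
    then show ?thesis using IH ex True by simp
  next
    case False
    then have "potential N ?x + potential N ?y + 2 * int (shared N ?x ?y) \<le> 2"
      using pD potential_matched[OF bb] by blast
    then show ?thesis using IH ex False by simp
  qed
qed

lemma sum_squeeze:
  fixes f g :: "nat \<Rightarrow> int"
  assumes "\<And>s. s < N \<Longrightarrow> g s \<le> f s" "(\<Sum>s<N. f s) \<le> (\<Sum>s<N. g s)" "s < N"
  shows "f s \<le> g s"
proof (rule ccontr)
  assume "\<not> f s \<le> g s"
  then have "(\<Sum>s<N. g s) < (\<Sum>s<N. f s)"
    using assms(1,3) by (intro sum_strict_mono_ex1) (auto intro!: bexI[of _ s])
  then show False using assms(2) by simp
qed

text \<open>Inserting the length of a minimum path into the dual bound leaves a total excess of at
  most the sum of the lower bounds for the single levels, so equality holds at every level.\<close>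

lemma min_path_tight:
  assumes bb: "based_below N" and fe: "feasible N" and aug: "enat N \<le> min_aug"
    and p: "min_path v p" and tv: "ten v \<le> enat N" and s: "s < N"
  shows "tight s p"
proof -
  note pD = min_pathD[OF p]
  define L where "L = length p - 1"
  have Ll: "L < length p" using pD(4) unfolding L_def by simp
  obtain n where n: "ten v = enat n" "n \<le> N" using tv by (cases "ten v") auto
  obtain e where e: "level True v = enat e" using level_finite[of v True] n by auto
  have pot: "potential N v = 2 * int e - int N" using potential_outer[OF e] tv by blast
  \<comment> \<open>For odd \<open>L\<close> this is -1 exactly at the \<open>N - n\<close> levels
    from \<open>n\<close> on, where \<open>n\<close> is the tenacity of \<open>v\<close>.\<close>
  define low where "low s = - (of_bool (odd L \<and> ten v \<le> enat s) :: int)" for s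
  have "{s. s < N \<and> n \<le> s} = {n..<N}" by auto
  then have sum_low: "(\<Sum>s<N. low s) = (if odd L then - int (N - n) else 0)"
    using n by (auto simp: low_def sum_negf of_bool_def sum.If_cases Int_def lessThan_def)
  have "int N + (if even L then potential N v else - potential N v)
           + 2 * (\<Sum>s<N. excess s p L) \<le> 2 * int L"
    using length_ge_potential[OF bb fe pD(1), of L] pD(5)[folded L_def] Ll by (simp split: if_splits)
  moreover have "int L = (if even L then int e else int n - int e)"
    using pD(7) e n(1) unfolding L_def ten_eq_levels[of v "even L"] by (auto simp: ten_def L_def)
  ultimately have "(\<Sum>s<N. excess s p L) \<le> (\<Sum>s<N. low s)"
    using sum_low pot n(2) by (auto split: if_splits)
  moreover have "low s \<le> excess s p L" if "s < N" for s
    using excess_lower[OF bb that pD(1) aug] pD(6) unfolding low_def L_def by simp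
  ultimately have "excess s p L \<le> low s"
    using s sum_squeeze[of N low "\<lambda>s. excess s p L" s] by blast
  then show ?thesis using tight_if_excess_low[OF bb s pD(1) aug] pD(6) unfolding low_def L_def by simp
qed

section \<open>Independence of the base from the path\<close>

lemma finite_if_le: "t \<le> enat N \<Longrightarrow> t \<noteq> \<infinity>"
  by (cases t) auto

lemma level_index_unique:
  assumes "level (even i) x = enat i" "level (even j) x = enat j" "even i = even j"
  shows "i = j"
proof -
  have "enat i = level (even i) x" using assms(1) by (rule sym)
  also have "\<dots> = level (even j) x" by (rule arg_cong[OF assms(3)])
  also have "\<dots> = enat j" by (rule assms(2))
  finally show ?thesis by (rule enat.inject[THEN iffD1])
qed

lemma ten_eq_lengths:
  assumes "min_path v p" "min_path v r" "even (length p - 1) \<noteq> even (length r - 1)"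
  shows "ten v = enat ((length p - 1) + (length r - 1))"
proof -
  have "even (length r - 1) = (\<not> even (length p - 1))" using assms(3) by blast
  then have "level (\<not> even (length p - 1)) v = enat (length r - 1)"
    using min_pathD(7)[OF assms(2)] by simp
  then show ?thesis
    unfolding ten_eq_levels[of v "even (length p - 1)"] min_pathD(7)[OF assms(1)] by simp
qed

text \<open>An even path would end with a matched edge whose ends both have tenacity above
  \<open>s\<close>, hence are their own \<open>beta s\<close>; but contiguity puts both into one
  blossom.\<close>

lemma tight_ending_odd:
  assumes p: "search_path p" and t: "tight s p" and k: "k < length p - 1"
    and b: "beta s (p ! k) = last p" and hi: "enat s < ten (last p)"
  shows "odd (length p - 1)"
proof
  assume ev: "even (length p - 1)"
  note pD = search_pathD[OF p]
  obtain l where l: "length p = Suc (Suc l)" using k by (cases "length p"; cases "length p - 1") auto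
  have last: "last p = p ! Suc l" using l pD(1) by (simp add: last_conv_nth)
  have "{p ! l, p ! Suc l} \<in> M" using pD(6)[of l] l ev by simp
  then have "enat s < ten (p ! l)" using ten_mate[of "p ! l" "p ! Suc l"] hi last by simp
  then have "beta s (p ! l) = p ! l" by (rule beta_eq_self)
  moreover have "beta s (p ! Suc l) = p ! Suc l" using beta_eq_self hi last by simp
  then have "beta s (p ! l) = p ! Suc l"
    using tight_between[OF t, of k l "Suc l"] k b l last by simp
  ultimately show False using pD(2) l by (simp add: nth_eq_iff_index_eq)
qed

text \<open>Look where \<open>r\<close> first meets the part of \<open>p\<close> from
  \<open>h\<close> on. Opposite parities would give \<open>p ! h\<close> tenacity at most
  \<open>N\<close>. With equal parities, the induction hypothesis applies at the meeting vertex or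
  at the base of its blossom.\<close>

lemma last_above_mem_opposite:
  assumes bb: "based_below N" and fe: "feasible N" and aug: "enat N < min_aug"
    and tv: "ten v = enat N" and p: "min_path v p" and r: "min_path v r"
    and par: "even (length p - 1) \<noteq> even (length r - 1)" and h: "last_above (enat N) p h"
    and IH: "\<And>z c l P R i j. ten z = enat N \<Longrightarrow> level c z = enat l \<Longrightarrow> l < length p - 1 \<Longrightarrow>
      l < length r - 1 \<Longrightarrow> min_path z P \<Longrightarrow> min_path z R \<Longrightarrow> last_above (enat N) P i \<Longrightarrow>
      last_above (enat N) R j \<Longrightarrow> P ! i = R ! j"
  shows "p ! h \<in> set r"
proof -
  note pD = min_pathD[OF p] and rD = min_pathD[OF r]
  define L m where "L = length p - 1" and "m = length r - 1"
  have len: "length p = Suc L" "length r = Suc m" using pD(4) rD(4) unfolding L_def m_def by auto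
  have pL: "p ! L = v" "r ! m = v" using pD rD unfolding L_def m_def by auto
  have NLm: "N = L + m"
    using ten_eq_lengths[OF p r par] tv unfolding L_def m_def by simp
  have fin: "ten v \<noteq> \<infinity>" using tv by simp
  have hD: "h < length p" "enat N < ten (p ! h)" "\<And>k. h < k \<Longrightarrow> k < length p \<Longrightarrow> ten (p ! k) \<le> enat N"
    using h unfolding last_above_def by (auto simp: not_less[symmetric])
  \<comment> \<open>At such a common vertex after \<open>h\<close> both prefixes are minimum and
    shorter than \<open>p\<close> and \<open>r\<close>, so by \<open>IH\<close> their last vertices
    above \<open>N\<close> agree; on \<open>p\<close> this is still \<open>p ! h\<close>.\<close>
  have key: "p ! h \<in> set r"
    if k: "h \<le> k" "k < length p" "j < length r" "p ! k = r ! j" "even k = even j" "enat N \<le> ten (p ! k)"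
    for k j
  proof (cases "k = h")
    case True
    then show ?thesis using k by simp
  next
    case False
    then have hk: "h < k" using k by simp
    have tz: "ten (p ! k) = enat N" using hD(3)[OF hk k(2)] k(6) by (rule order_antisym)
    have "k = L \<longleftrightarrow> j = m" using k pL len pD(3) rD(3) nth_eq_iff_index_eq by (metis lessI)
    then have kj: "k < L" "j < m" using k len par unfolding L_def[symmetric] m_def[symmetric] by auto
    have lk: "level (even k) (p ! k) = enat k" "level (even j) (r ! j) = enat j"
      using level_on_min_path[OF p fin k(2)] level_on_min_path[OF r fin k(3)] k(4,6) tv by simp_all
    then have "j = k" using level_index_unique k(4,5) by metis
    have "min_path (p ! k) (take (Suc k) p)" "min_path (p ! k) (take (Suc j) r)"
      using min_path_take[OF pD(1) k(2) lk(1)] min_path_take[OF rD(1) k(3) lk(2)] k(4) by simp_all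
    moreover obtain g where g: "last_above (enat N) (take (Suc j) r) g"
      using last_above_exists[OF search_path_take[OF rD(1) k(3)] aug] .
    ultimately have "take (Suc k) p ! h = take (Suc j) r ! g"
      using IH[OF tz lk(1)] kj \<open>j = k\<close> last_above_take[OF h hk k(2)] unfolding L_def m_def by blast
    then have "p ! h = r ! g" "g < length r" using g hk unfolding last_above_def by auto
    then show ?thesis by simp
  qed
  have "m < length r" "r ! m \<in> set (drop h p)"
    using last_in_drop[OF hD(1)] pD(6) pL len by auto
  with p hD(1) rD(1) show ?thesis
  proof (cases rule: first_meeting)
    case (2 j k)
    have "ten (p ! h) = level (even h) (p ! h) + level (odd h) (p ! h)" using ten_eq_levels by metis
    also have "\<dots> \<le> enat h + enat (j + (k - h))" using 2 level_le[OF pD(1) hD(1)] by (intro add_mono)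
    also have "\<dots> \<le> enat N" using 2 NLm len by simp
    finally show ?thesis using hD(2) by simp
  next
    case (1 j k)
    show ?thesis
    proof (cases "enat N \<le> ten (p ! k)")
      case True
      then show ?thesis using key[of k j] 1(1-4,6) len by simp
    next
      case False
      \<comment> \<open>The meeting vertex lies in a blossom of level \<open>N - 1\<close>, whose
        base \<open>c\<close> has tenacity at least \<open>N\<close> and, by tightness, lies on both
        paths.\<close>
      define n where "n = N - 1"
      have "N \<noteq> 0" using False by (metis zero_enat_def zero_le)
      then have n: "N = Suc n" "n < N" unfolding n_def by auto
      have tp: "tight n p" "tight n r"
        using min_path_tight[OF bb fe _ p _ n(2)] min_path_tight[OF bb fe _ r _ n(2)] aug tv by auto
      define c where "c = beta n (p ! k)"
      have tc: "enat n < ten c" using ten_beta[OF bb n(2)] unfolding c_def .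
      then have Nc: "enat N \<le> ten c" unfolding n(1) by (cases "ten c") auto
      have bc: "beta n c = c" using beta_eq_self[OF tc] .
      obtain k' where k': "k' < length p" "p ! k' = c"
        using tight_beta_mem[OF tp(1) 1(3)] unfolding c_def in_set_conv_nth by auto
      obtain j' where j': "j' < length r" "r ! j' = c"
        using tight_beta_mem[OF tp(2), of j] 1 len unfolding c_def in_set_conv_nth by auto
      have "h \<le> k'"
      proof (rule ccontr)
        assume "\<not> h \<le> k'"
        then have "beta n (p ! h) = c"
          using tight_between[OF tp(1), of k' h k] 1 k' bc c_def by simp
        moreover have "enat n < ten (p ! h)" using hD(2) n by (metis enat_ord_simps(2) less_trans)
        ultimately have "p ! h = p ! k'" using beta_eq_self k' by simp
        then show False using pD(3) hD(1) k'(1) \<open>\<not> h \<le> k'\<close> by (simp add: nth_eq_iff_index_eq)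
      qed
      show ?thesis
      proof (cases "even k' = even j'")
        case True
        then show ?thesis using key[of k' j'] \<open>h \<le> k'\<close> k' j' Nc by simp
      next
        case opp: False
        \<comment> \<open>Opposite parities at \<open>c\<close> leave only \<open>c = v\<close>;
          then both paths would end oddly, contradicting \<open>par\<close>.\<close>
        have "ten c = level (even k') c + level (even j') c" using ten_eq_levels[of c "even k'"] opp by simp
        also have "\<dots> \<le> enat k' + enat j'"
          using level_le[OF pD(1) k'(1)] level_le[OF rD(1) j'(1)] k' j' by (intro add_mono) auto
        finally have "enat N \<le> enat (k' + j')" using Nc by (metis order_trans plus_enat_simps(1))
        then have "k' = L" "j' = m" using NLm k' j' len by auto
        then have cv: "c = v" using pL k' by simp
        have "p ! k \<noteq> v" using False tv by auto
        then have "k \<noteq> L" "j \<noteq> m" using pL 1 by auto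
        then have "k < length p - 1" "j < length r - 1" using 1 len by auto
        then have "odd (length p - 1)" "odd (length r - 1)"
          using tight_ending_odd[OF pD(1) tp(1), of k] tight_ending_odd[OF rD(1) tp(2), of j]
            cv c_def tc 1 pD(6) rD(6) by auto
        then show ?thesis using par by simp
      qed
    qed
  qed
qed

text \<open>Both indices of \<open>p ! i\<close> are levels of it. With opposite parities they would
  add up to its tenacity and give at most \<open>N\<close>, so they coincide. Exchanging the roles
  of \<open>p\<close> and \<open>r\<close> then gives \<open>i = j\<close>.\<close>

lemma last_above_index_le:
  assumes tv: "ten v = enat N" and p: "min_path v p" and r: "min_path v r"
    and par: "even (length p - 1) \<noteq> even (length r - 1)"
    and i: "last_above (enat N) p i" and j: "last_above (enat N) r j" and mem: "p ! i \<in> set r"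
  shows "i \<le> j \<and> p ! i = r ! i"
proof -
  note pD = min_pathD[OF p] and rD = min_pathD[OF r]
  have fin: "ten v \<noteq> \<infinity>" using tv by simp
  have iD: "i < length p" "enat N < ten (p ! i)" using i unfolding last_above_def by auto
  obtain k where k: "k < length r" "r ! k = p ! i" using mem unfolding in_set_conv_nth by auto
  have kj: "k \<le> j" using j k iD unfolding last_above_def by auto
  have lv: "level (even i) (p ! i) = enat i" "level (even k) (p ! i) = enat k"
    using level_on_min_path[OF p fin iD(1)] level_on_min_path[OF r fin k(1)] iD tv k by auto
  have "i = k"
  proof (cases "even i = even k")
    case False
    then have "ten (p ! i) = enat (i + k)" using ten_eq_levels[of "p ! i" "even i"] lv by simp
    moreover have "N = (length p - 1) + (length r - 1)"
      using ten_eq_lengths[OF p r par] tv by simp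
    ultimately show ?thesis using iD k(1) by simp
  qed (use lv in \<open>blast intro: level_index_unique\<close>)
  then show ?thesis using kj k(2) by metis
qed

lemma last_above_path_independent:
  assumes bb: "based_below N" and fe: "feasible N" and aug: "enat N < min_aug"
  shows "ten v = enat N \<Longrightarrow> min_path v p \<Longrightarrow> min_path v r \<Longrightarrow>
    last_above (enat N) p i \<Longrightarrow> last_above (enat N) r j \<Longrightarrow> p ! i = r ! j"
proof (induction "the_enat (min (level True v) (level False v))" arbitrary: v p r i j rule: less_induct)
  case less
  have fin: "ten v \<noteq> \<infinity>" using less.prems(1) by simp
  have opp: "P ! a = Q ! b"
    if P: "min_path v P" and Q: "min_path v Q" and par: "even (length P - 1) \<noteq> even (length Q - 1)"
      and a: "last_above (enat N) P a" and b: "last_above (enat N) Q b" for P Q a b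
  proof -
    have IH: "P' ! a' = Q' ! b'"
      if "ten z = enat N" "level c z = enat l" "l < length P - 1" "l < length Q - 1"
        "min_path z P'" "min_path z Q'" "last_above (enat N) P' a'" "last_above (enat N) Q' b'"
      for z c l P' Q' a' b'
    proof (rule less.hyps[OF _ that(1,5-8)])
      have "min (level True z) (level False z) \<le> enat l" using that(2) by (cases c) auto
      moreover have "min (level True v) (level False v) = enat (min (length P - 1) (length Q - 1))"
        using min_pathD(7)[OF P] min_pathD(7)[OF Q] par
        by (cases "even (length P - 1)") (auto simp: min.commute)
      ultimately show "the_enat (min (level True z) (level False z)) <
          the_enat (min (level True v) (level False v))"
        using that(3,4) by (cases "min (level True z) (level False z)") auto
    qed
    have "P ! a \<in> set Q"
      by (rule last_above_mem_opposite[OF bb fe aug less.prems(1) P Q par a]) (rule IH)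
    moreover have "Q ! b \<in> set P"
      by (rule last_above_mem_opposite[OF bb fe aug less.prems(1) Q P par[symmetric] b]) (rule IH)
    ultimately have "a \<le> b \<and> P ! a = Q ! a" "b \<le> a"
      using last_above_index_le[OF less.prems(1) P Q par a b]
        last_above_index_le[OF less.prems(1) Q P par[symmetric] b a] by auto
    then show ?thesis by (metis order_antisym)
  qed
  \<comment> \<open>Two paths of equal parity are compared through a third one of the other
    parity.\<close>
  obtain q where q: "min_path v q" "even (length q - 1) = odd (length p - 1)"
    using level_finite[OF fin] by (rule min_path_exists)
  obtain k where k: "last_above (enat N) q k" using last_above_exists[OF min_pathD(1)[OF q(1)] aug] .
  show ?case
  proof (cases "even (length p - 1) = even (length r - 1)")
    case True
    then have "p ! i = q ! k" "r ! j = q ! k"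
      using opp[OF less.prems(2) q(1) _ less.prems(4) k] opp[OF less.prems(3) q(1) _ less.prems(5) k] q(2)
      by blast+
    then show ?thesis by simp
  next
    case False
    then show ?thesis using opp less.prems by blast
  qed
qed

lemma furthest_iff:
  "furthest_of_higher_tenacity V E M t p b \<longleftrightarrow> (\<exists>i. last_above t p i \<and> p ! i = b)"
  unfolding furthest_of_higher_tenacity_def last_above_def tenacity_eq by blast

lemma based_below_Suc:
  assumes bb: "based_below N" and fe: "feasible N" and aug: "enat N < min_aug"
  shows "based_below (Suc N)"
  unfolding based_below_def
proof (intro allI impI)
  fix v assume "ten v < enat (Suc N)"
  then consider "ten v < enat N" | "ten v = enat N" by (cases "ten v") (auto simp: less_Suc_eq)
  then show "well_based v"
  proof cases
    case 1
    then show ?thesis using bb unfolding based_below_def by blast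
  next
    case 2
    then have "level True v \<noteq> \<infinity>" using level_finite by auto
    then obtain p where p: "min_path v p" by (rule min_path_exists)
    obtain i where i: "last_above (enat N) p i" using last_above_exists[OF min_pathD(1)[OF p] aug] .
    have all: "\<forall>q. min_path v q \<longrightarrow> (\<exists>j. last_above (enat N) q j \<and> q ! j = p ! i)"
    proof (intro allI impI)
      fix q assume q: "min_path v q"
      obtain j where j: "last_above (enat N) q j" using last_above_exists[OF min_pathD(1)[OF q] aug] .
      then show "\<exists>j. last_above (enat N) q j \<and> q ! j = p ! i"
        using last_above_path_independent[OF bb fe aug 2 q p j i] by blast
    qed
    have "base V E M v = p ! i"
      unfolding base_def min_path_iff[symmetric] furthest_iff tenacity_eq 2
      using all p i last_above_unique by (intro the_equality) blast+
    then show ?thesis using all 2 unfolding well_based_def by simp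
  qed
qed

section \<open>Feasibility at the next time step\<close>

context
  fixes N :: nat
  assumes bb: "based_below (Suc N)" and fe: "feasible N" and aug: "enat N < min_aug"
begin

lemma based_below_N: "based_below N"
proof -
  have "t < enat (Suc N)" if "t < enat N" for t using that by (cases t) auto
  then show ?thesis using bb unfolding based_below_def by blast
qed

text \<open>Tightness at level \<open>N - 1\<close> puts the penultimate iterate on
  \<open>p\<close>. If its tenacity is exactly \<open>N\<close>, the prefix of \<open>p\<close> up
  to it is a minimum path and contains its base by definition.\<close>

lemma beta_mem:
  assumes p: "min_path v p" and tv: "ten v \<le> enat N" and u: "u \<in> set p"
  shows "beta N u \<in> set p"
proof (cases N)
  case 0
  then show ?thesis using u by simp
next
  case (Suc n)
  have "tight n p" using min_path_tight[OF based_below_N fe _ p tv, of n] aug Suc by simp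
  then have c: "beta n u \<in> set p" using tight_beta_mem u by (metis in_set_conv_nth)
  show ?thesis
  proof (cases "ten (beta n u) = enat N")
    case True
    obtain k where k: "k < length p" "p ! k = beta n u" using c unfolding in_set_conv_nth by auto
    have "ten v \<noteq> \<infinity>" using finite_if_le[OF tv] .
    then have "min_path (beta n u) (take (Suc k) p)" using min_path_prefix[OF p _ k(1)] k True tv by simp
    moreover have "well_based (beta n u)" using bb True unfolding based_below_def by simp
    ultimately have "base V E M (beta n u) \<in> set (take (Suc k) p)"
      unfolding well_based_def last_above_def by (metis nth_mem)
    then show ?thesis using True Suc by (auto dest: in_set_takeD)
  qed (use c Suc in simp)
qed

text \<open>Let \<open>c\<close> be the iterate at level \<open>N - 1\<close>. If its tenacity
  exceeds \<open>N\<close>, it is not after \<open>h\<close>, and contiguity forces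
  \<open>c = p ! h\<close>. Otherwise it comes after \<open>h\<close>, and the prefix ending in
  \<open>c\<close> shows that its base is \<open>p ! h\<close>.\<close>

lemma beta_after_last_above:
  assumes p: "min_path v p" and tv: "ten v \<le> enat N" and h: "last_above (enat N) p h"
    and k: "h < k" "k < length p"
  shows "beta N (p ! k) = p ! h"
proof -
  have "N \<noteq> 0" using tv ten_pos[of v] by (cases N) (auto simp: zero_enat_def)
  then obtain n where n: "N = Suc n" by (cases N) auto
  have tp: "tight n p" using min_path_tight[OF based_below_N fe _ p tv, of n] aug n by simp
  have fin: "ten v \<noteq> \<infinity>" using finite_if_le[OF tv] .
  have dist: "distinct p" using min_pathD(3)[OF p] .
  have hD: "h < length p" "enat N < ten (p ! h)" "\<And>k. k < length p \<Longrightarrow> enat N < ten (p ! k) \<Longrightarrow> k \<le> h"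
    using h unfolding last_above_def by auto
  define c where "c = beta n (p ! k)"
  have tc: "enat n < ten c" using ten_beta[OF based_below_N, of n] n unfolding c_def by simp
  obtain k' where k': "k' < length p" "p ! k' = c"
    using tight_beta_mem[OF tp k(2)] unfolding c_def in_set_conv_nth by auto
  have hk': "p ! h = c" if "k' \<le> h"
  proof -
    have "beta n (p ! k') = beta n (p ! k)" using beta_eq_self[OF tc] k' c_def by simp
    then have "beta n (p ! h) = c"
      using tight_between[OF tp that, of k] k k' beta_eq_self[OF tc] by simp
    moreover have "enat n < ten (p ! h)" using hD(2) n by (metis enat_ord_simps(2) lessI less_trans)
    ultimately show ?thesis using beta_eq_self by simp
  qed
  show ?thesis
  proof (cases "ten c = enat N")
    case False
    then have "enat N < ten c" using enat_Suc_cases[OF tc] n by simp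
    then have "p ! h = c" using hk' hD(3) k' by blast
    then show ?thesis using False n c_def by simp
  next
    case True
    then have "h < k'" using hk' hD(2) by (metis less_irrefl not_le)
    have "min_path c (take (Suc k') p)" using min_path_prefix[OF p fin k'(1)] k' True tv by simp
    moreover have "well_based c" using bb True unfolding based_below_def by simp
    ultimately obtain i where i: "last_above (enat N) (take (Suc k') p) i" "take (Suc k') p ! i = base V E M c"
      using True unfolding well_based_def by metis
    have "i = h" using last_above_unique[OF i(1)] last_above_take[OF h \<open>h < k'\<close> k'(1)] by blast
    then show ?thesis using i(2) \<open>h < k'\<close> True n c_def by simp
  qed
qed

text \<open>The index \<open>h\<close> is even, since a matched edge leaving \<open>p ! h\<close>
  would carry the tenacity above \<open>N\<close> past the last such vertex. It is less than both
  levels of \<open>x\<close>, whose sum is at most \<open>N\<close>.\<close>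

lemma beta_position:
  assumes tx: "ten x \<le> enat N"
  obtains h where "level True (beta N x) = enat h" "2 * h < N" "enat N < ten (beta N x)"
    "\<forall>p. min_path x p \<longrightarrow> h < length p - 1 \<and> p ! h = beta N x \<and> last_above (enat N) p h"
proof -
  have fin: "ten x \<noteq> \<infinity>" using finite_if_le[OF tx] .
  have main: "\<exists>h. level True (beta N x) = enat h \<and> h < length p - 1 \<and> p ! h = beta N x \<and> last_above (enat N) p h"
    if p: "min_path x p" for p
  proof -
    note pD = min_pathD[OF p]
    obtain h where h: "last_above (enat N) p h" using last_above_exists[OF pD(1) aug] .
    then have hD: "h < length p" "enat N < ten (p ! h)" "\<And>k. k < length p \<Longrightarrow> enat N < ten (p ! k) \<Longrightarrow> k \<le> h"
      unfolding last_above_def by auto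
    have "h \<noteq> length p - 1" using hD(2) pD(5) tx by auto
    then have hl: "h < length p - 1" using hD(1) by simp
    have b: "p ! h = beta N x" using beta_after_last_above[OF p tx h hl] pD(4,5) by simp
    have "even h"
    proof (rule ccontr)
      assume "odd h"
      then have "{p ! h, p ! Suc h} \<in> M" using search_pathD(6)[OF pD(1), of h] hl by simp
      then have "enat N < ten (p ! Suc h)" using ten_mate hD(2) by metis
      then show False using hD(3)[of "Suc h"] hl by linarith
    qed
    moreover have "ten x \<le> ten (p ! h)" using hD(2) tx by simp
    ultimately have "level True (beta N x) = enat h"
      using level_on_min_path[OF p fin hD(1)] b by simp
    then show ?thesis using hl b h by blast
  qed
  obtain p where p: "min_path x p" "even (length p - 1) = True"
    using level_finite[OF fin] by (rule min_path_exists)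
  obtain r where r: "min_path x r" "even (length r - 1) = False"
    using level_finite[OF fin] by (rule min_path_exists)
  obtain h where h: "level True (beta N x) = enat h" "h < length p - 1" "p ! h = beta N x" "last_above (enat N) p h"
    using main[OF p(1)] by blast
  have all: "h < length q - 1 \<and> q ! h = beta N x \<and> last_above (enat N) q h" if "min_path x q" for q
    using main[OF that] h(1) by auto
  have "ten x = enat ((length p - 1) + (length r - 1))"
    using min_pathD(7)[OF p(1)] min_pathD(7)[OF r(1)] p(2) r(2) unfolding ten_def by simp
  then have "(length p - 1) + (length r - 1) \<le> N" using tx by simp
  moreover have "h < length r - 1" using all[OF r(1)] by blast
  ultimately have "2 * h < N" using h(2) by linarith
  moreover have "enat N < ten (beta N x)" using h unfolding last_above_def by auto
  ultimately show ?thesis using that h(1) all by blast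
qed

text \<open>The path \<open>q\<close> avoids the part of \<open>p\<close> from the base on, since
  any common vertex would bring the base onto \<open>q\<close>. Hence \<open>q\<close>, the edge and
  \<open>p\<close> backwards form an odd path to the base, whose tenacity exceeds
  \<open>N\<close>.\<close>

lemma even_levels_ge_if_not_mem:
  assumes tx: "ten x \<le> enat N" and e: "{y, x} \<in> E" "{y, x} \<notin> M"
    and p: "min_path x p" "odd (length p)" and q: "min_path y q" "odd (length q)"
    and ty: "ten y \<le> enat N" and nm: "beta N x \<notin> set q"
  shows "N \<le> (length p - 1) + (length q - 1)"
proof -
  note pD = min_pathD[OF p(1)] and qD = min_pathD[OF q(1)]
  obtain h where h0: "level True (beta N x) = enat h" "2 * h < N" "enat N < ten (beta N x)"
    "\<forall>p. min_path x p \<longrightarrow> h < length p - 1 \<and> p ! h = beta N x \<and> last_above (enat N) p h"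
    by (rule beta_position[OF tx])
  have h: "level True (beta N x) = enat h" "2 * h < N" "enat N < ten (beta N x)"
    "h < length p - 1" "p ! h = beta N x" "last_above (enat N) p h"
    using h0(1-3) h0(4) p(1) by auto
  have "set q \<inter> set (drop h p) = {}"
  proof (rule ccontr)
    assume "set q \<inter> set (drop h p) \<noteq> {}"
    then obtain u where u: "u \<in> set q" "u \<in> set (drop h p)" by blast
    obtain d where d: "d < length (drop h p)" "drop h p ! d = u" using u(2) unfolding in_set_conv_nth by blast
    then have "h + d < length p" "p ! (h + d) = u" by auto
    then have "beta N u = beta N x"
      using beta_after_last_above[OF p(1) tx h(6), of "h + d"] h(3,5) beta_eq_self
      by (cases "d = 0") auto
    then show False using beta_mem[OF q(1) ty u(1)] nm by simp
  qed
  then have "level (odd h) (p ! h) \<le> enat (length q + (length p - 1 - h))"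
    using p q e pD(6) qD(6) h(4) by (intro splice_edge[OF pD(1) qD(1)]) auto
  moreover have "level (even h) (p ! h) \<le> enat h" using level_le[OF pD(1)] h(4) by simp
  ultimately have "ten (p ! h) \<le> enat h + enat (length q + (length p - 1 - h))"
    unfolding ten_eq_levels[of "p ! h" "even h"] by (intro add_mono) auto
  then have "enat N < enat (h + (length q + (length p - 1 - h)))"
    using h(3,5) by (metis order.strict_trans2 plus_enat_simps(1))
  then show ?thesis using h(4) qD(4) by simp
qed

text \<open>On \<open>q\<close> the vertex \<open>beta N x\<close> precedes \<open>beta N y\<close>.
  An odd index is impossible, as it would make the tenacity of \<open>beta N x\<close> smaller than
  \<open>N\<close>.\<close>

lemma base_level_less_if_mem:
  assumes tx: "ten x \<le> enat N" and ty: "ten y \<le> enat N" and q: "min_path y q"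
    and m: "beta N x \<in> set q" and ne: "beta N x \<noteq> beta N y"
  shows "level True (beta N x) < level True (beta N y)"
proof -
  obtain h where h: "level True (beta N x) = enat h" "2 * h < N" "enat N < ten (beta N x)"
    by (rule beta_position[OF tx])
  obtain g where g0: "level True (beta N y) = enat g" "2 * g < N" "enat N < ten (beta N y)"
    "\<forall>p. min_path y p \<longrightarrow> g < length p - 1 \<and> p ! g = beta N y \<and> last_above (enat N) p g"
    by (rule beta_position[OF ty])
  have g: "level True (beta N y) = enat g" "2 * g < N" "q ! g = beta N y" "last_above (enat N) q g"
    using g0(1,2,4) q by auto
  obtain k where k: "k < length q" "q ! k = beta N x" using m unfolding in_set_conv_nth by auto
  have "k \<le> g" "k \<noteq> g" using g k h ne unfolding last_above_def by auto
  then have kg: "k < g" by simp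
  have "ten y \<le> ten (q ! k)" "ten y \<noteq> \<infinity>" using k h(3) ty finite_if_le[OF ty] by auto
  then have lv: "level (even k) (beta N x) = enat k" using level_on_min_path[OF q _ k(1)] k by simp
  show ?thesis
  proof (cases "even k")
    case True
    then show ?thesis using lv g(1) kg by simp
  next
    case False
    then have "ten (beta N x) = enat (h + k)" using lv h(1) unfolding ten_def by simp
    then show ?thesis using h g kg by simp
  qed
qed

lemma even_levels_ge:
  assumes e: "{x, y} \<in> E" "{x, y} \<notin> M" and tx: "ten x \<le> enat N" and ty: "ten y \<le> enat N"
    and ne: "beta N x \<noteq> beta N y" and l: "level True x = enat a" "level True y = enat b"
  shows "N \<le> a + b"
proof -
  have "level True x \<noteq> \<infinity>" "level True y \<noteq> \<infinity>" using l by auto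
  then obtain p q where p: "min_path x p" "even (length p - 1) = True"
    and q: "min_path y q" "even (length q - 1) = True" using min_path_exists by metis
  have ab: "length p - 1 = a" "length q - 1 = b"
    using min_pathD(7)[OF p(1)] min_pathD(7)[OF q(1)] p(2) q(2) l by auto
  have odd: "odd (length p)" "odd (length q)"
    using p(2) q(2) min_pathD(4)[OF p(1)] min_pathD(4)[OF q(1)] by auto
  have e': "{y, x} \<in> E" "{y, x} \<notin> M" using e by (auto simp: insert_commute)
  consider "beta N x \<notin> set q" | "beta N y \<notin> set p" | "beta N x \<in> set q" "beta N y \<in> set p" by blast
  then show ?thesis
  proof cases
    case 1
    then show ?thesis using even_levels_ge_if_not_mem[OF tx e' p(1) odd(1) q(1) odd(2) ty] ab by simp
  next
    case 2
    then show ?thesis using even_levels_ge_if_not_mem[OF ty e q(1) odd(2) p(1) odd(1) tx] ab by simp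
  next
    \<comment> \<open>Each base would have a smaller even level than the other.\<close>
    case 3
    then show ?thesis
      using base_level_less_if_mem[OF tx ty q(1)] base_level_less_if_mem[OF ty tx p(1)] ne
      by (metis less_asym)
  qed
qed

end

lemma level_False_le_if_notin:
  assumes p: "min_path x p" "odd (length p)" and e: "{x, y} \<in> E" "{x, y} \<notin> M" and y: "y \<notin> set p"
  shows "level False y \<le> enat (length p)"
proof -
  note pD = min_pathD[OF p(1)]
  have "search_path (p @ [y])" using pD p e y by (intro search_path_snoc) auto
  from level_le_path[OF this] show ?thesis using p(2) by simp
qed

text \<open>With tenacity at least \<open>N\<close>, the potential of \<open>y\<close> is in all
  three cases at least \<open>N\<close> minus twice its odd level.\<close>

lemma potential_sum_ge:
  assumes x: "potential N x = 2 * int e - int N" and ty: "enat N \<le> ten y"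
    and le: "level False y \<le> enat (Suc e)"
  shows "- 2 \<le> potential N x + potential N y"
proof -
  obtain b where b: "level False y = enat b" "b \<le> Suc e" using le by (cases "level False y") auto
  show ?thesis using x ty b unfolding potential_def[of N y] ten_def
    by (cases "level True y") auto
qed

text \<open>If \<open>x\<close> is not outer, neither is \<open>y\<close>, and both potentials are
  nonnegative. Otherwise \<open>y\<close> extends the even path to \<open>x\<close> or lies on it,
  there at an odd index because its even level is not smaller.\<close>

lemma potential_sum_ge_above:
  assumes e: "{x, y} \<in> E" "{x, y} \<notin> M" and t: "enat N \<le> ten x" "enat N \<le> ten y"
    and le: "level True x \<le> level True y"
  shows "- 2 \<le> potential N x + potential N y"
proof (cases "level True x + level True x < enat N")
  case False
  then have "\<not> level True y + level True y < enat N"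
    using le by (meson add_mono le_less_trans)
  then have "0 \<le> potential N x" "0 \<le> potential N y"
    using False t unfolding potential_def
    by (auto simp: not_less[symmetric]) (cases "level False x"; cases "level False y"; auto)+
  then show ?thesis by simp
next
  case True
  then obtain a where a: "level True x = enat a" "2 * a < N" by (cases "level True x") auto
  then have "level True x \<noteq> \<infinity>" by simp
  then obtain p where p: "min_path x p" "even (length p - 1) = True" by (rule min_path_exists)
  note pD = min_pathD[OF p(1)]
  have len: "length p = Suc a" "odd (length p)" using pD(4,7) p(2) a by auto
  have "level False y \<le> enat (Suc a)"
  proof (cases "y \<in> set p")
    case False
    then show ?thesis using level_False_le_if_notin[OF p(1) len(2) e] len by simp
  next
    case yp: True
    obtain k where k: "k < length p" "p ! k = y" using yp unfolding in_set_conv_nth by auto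
    have "k \<noteq> a" using edge_distinct[OF e(1)] k pD(5) len by auto
    then have lt: "k < a" using k len by simp
    have lv: "level (even k) y \<le> enat k" using level_le[OF pD(1) k(1)] k by simp
    then have "odd k" using le lt a by (cases "even k"; cases "level True y") auto
    then have "level False y \<le> enat k" using lv by simp
    also have "\<dots> \<le> enat (Suc a)" using lt by simp
    finally show ?thesis .
  qed
  then show ?thesis using potential_sum_ge potential_outer[OF a(1)] a(2) t by blast
qed

text \<open>The critical case has \<open>y\<close> at an even index \<open>k\<close> on the path to
  \<open>x\<close>, before the base. The prefix to \<open>y\<close>, the edge to \<open>x\<close>
  and the path backwards reach the base oddly, so its tenacity above \<open>N\<close> forces
  \<open>N \<le> k + a\<close>.\<close>

lemma potential_sum_ge_mixed:
  assumes bb: "based_below (Suc N)" and fe: "feasible N" and aug: "enat N < min_aug"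
    and e: "{x, y} \<in> E" "{x, y} \<notin> M" and tx: "ten x \<le> enat N" and ty: "enat N < ten y"
    and ne: "beta N x \<noteq> y"
  shows "- 2 \<le> potential (Suc N) x + potential (Suc N) y"
proof -
  have fin: "ten x \<noteq> \<infinity>" using finite_if_le[OF tx] .
  obtain p where p: "min_path x p" "even (length p - 1) = True"
    using level_finite[OF fin] by (rule min_path_exists)
  note pD = min_pathD[OF p(1)]
  define a where "a = length p - 1"
  have len: "length p = Suc a" "odd (length p)" using pD(4) p(2) unfolding a_def by auto
  have la: "level True x = enat a" using pD(7) p(2) a_def by simp
  have "ten x \<le> enat (Suc N)" using tx by (meson enat_ord_simps(1) le_SucI order_refl order_trans)
  then have px: "potential (Suc N) x = 2 * int a - int (Suc N)" using potential_outer[OF la] by blast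
  have ty': "enat (Suc N) \<le> ten y" using ty by (cases "ten y") auto
  obtain h where h0: "level True (beta N x) = enat h" "2 * h < N" "enat N < ten (beta N x)"
    "\<forall>p. min_path x p \<longrightarrow> h < length p - 1 \<and> p ! h = beta N x \<and> last_above (enat N) p h"
    by (rule beta_position[OF bb fe aug tx])
  have h: "level True (beta N x) = enat h" "2 * h < N" "enat N < ten (beta N x)"
    "h < length p - 1" "p ! h = beta N x" "last_above (enat N) p h"
    using h0(1-3) h0(4) p(1) by auto
  consider "y \<notin> set p" | k where "k < length p" "p ! k = y" by (auto simp: in_set_conv_nth)
  then show ?thesis
  proof cases
    case 1
    then have "level False y \<le> enat (Suc a)" using level_False_le_if_notin[OF p(1) len(2) e] len by simp
    then show ?thesis using potential_sum_ge[OF px ty'] by simp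
  next
    case k: 2
    have "k \<le> h" "k \<noteq> h" using h k ty ne unfolding last_above_def by auto
    then have kh: "k < h" by simp
    have lv: "level (even k) y = enat k" using level_on_min_path[OF p(1) fin k(1)] tx ty k by simp
    show ?thesis
    proof (cases "even k")
      case False
      then have "level False y \<le> enat (Suc a)" using lv kh h(4) a_def by simp
      then show ?thesis using potential_sum_ge[OF px ty'] by simp
    next
      case True
      have "set (take (Suc k) p) \<inter> set (drop h p) = {}"
        using set_take_disj_set_drop_if_distinct[OF pD(3), of "Suc k" h] kh by simp
      then have "level (odd h) (p ! h) \<le> enat (length (take (Suc k) p) + (length p - 1 - h))"
        using k h(4) len True e pD(6)
        by (intro splice_edge[OF pD(1) search_path_take[OF pD(1) k(1)]])
          (auto simp: last_take_Suc insert_commute min_absorb2)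
      moreover have "level (even h) (p ! h) \<le> enat h" using level_le[OF pD(1)] h(4) by simp
      ultimately have "ten (p ! h) \<le> enat h + enat (length (take (Suc k) p) + (length p - 1 - h))"
        unfolding ten_eq_levels[of "p ! h" "even h"] by (intro add_mono) auto
      then have "enat N < enat (h + (length (take (Suc k) p) + (length p - 1 - h)))"
        using h(3,5) by (metis order.strict_trans2 plus_enat_simps(1))
      then have "N \<le> k + a" using k h(4) len by (simp add: min_absorb2)
      moreover have "potential (Suc N) y = 2 * int k - int (Suc N)"
        using potential_outer[of y k "Suc N"] lv True kh h(2) by simp
      ultimately show ?thesis using px by simp
    qed
  qed
qed

text \<open>A vertex sharing its blossom with another one has tenacity at most \<open>N\<close> or
  is the base of the other; in both cases it is outer at both times.\<close>

lemma potential_Suc: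
  assumes bb: "based_below (Suc N)" and fe: "feasible N" and aug: "enat N < min_aug"
    and eq: "beta N x = beta N y" and ne: "x \<noteq> y"
  shows "potential (Suc N) x = potential N x - 1"
proof -
  have "\<exists>e. level True x = enat e \<and> (ten x \<le> enat N \<or> 2 * e < N)"
  proof (cases "ten x \<le> enat N")
    case True
    then show ?thesis using level_finite[of x True] by (cases "ten x") auto
  next
    case False
    then have "beta N x = x" using beta_eq_self by simp
    then have ty: "ten y \<le> enat N" using eq ne beta_eq_self by (metis not_le)
    obtain h where "level True (beta N y) = enat h" "2 * h < N"
      by (rule beta_position[OF bb fe aug ty])
    then show ?thesis using eq \<open>beta N x = x\<close> by simp
  qed
  then obtain e where e: "level True x = enat e" "ten x \<le> enat N \<or> 2 * e < N" by blast
  moreover have "ten x \<le> enat (Suc N) \<or> 2 * e < Suc N"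
    using e(2) by (cases "ten x") auto
  ultimately show ?thesis using potential_outer[OF e(1), of N] potential_outer[OF e(1), of "Suc N"] by simp
qed

text \<open>Inside a blossom both potentials drop by 1 and one more shared level adds 2. Across
  blossoms the potentials alone satisfy the bound, by cases on the two tenacities.\<close>

lemma feasible_Suc:
  assumes bb: "based_below (Suc N)" and fe: "feasible N" and aug: "enat N < min_aug"
  shows "feasible (Suc N)"
  unfolding feasible_def
proof (intro allI impI)
  fix x y assume e: "{x, y} \<in> E" "{x, y} \<notin> M"
  have ne: "x \<noteq> y" using edge_distinct[OF e(1)] .
  show "- 2 \<le> potential (Suc N) x + potential (Suc N) y + 2 * int (shared (Suc N) x y)"
  proof (cases "beta N x = beta N y")
    case True
    have "{s. s < Suc N \<and> beta s x = beta s y} = insert N {s. s < N \<and> beta s x = beta s y}"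
      using True by (auto simp: less_Suc_eq)
    then have "shared (Suc N) x y = Suc (shared N x y)" unfolding shared_def by simp
    moreover have "potential (Suc N) x = potential N x - 1" "potential (Suc N) y = potential N y - 1"
      using potential_Suc[OF bb fe aug True ne] potential_Suc[OF bb fe aug True[symmetric] ne[symmetric]] by auto
    ultimately show ?thesis using fe e unfolding feasible_def by fastforce
  next
    case False
    have e': "{y, x} \<in> E" "{y, x} \<notin> M" using e by (auto simp: insert_commute)
    have "- 2 \<le> potential (Suc N) x + potential (Suc N) y"
    proof (cases "ten x \<le> enat N"; cases "ten y \<le> enat N")
      assume t: "ten x \<le> enat N" "ten y \<le> enat N"
      then obtain a b where ab: "level True x = enat a" "level True y = enat b"
        using level_finite[of x True] level_finite[of y True] by (cases "ten x"; cases "ten y") auto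
      have "ten x \<le> enat (Suc N)" "ten y \<le> enat (Suc N)" using t by (cases "ten x"; cases "ten y"; simp)+
      then have "potential (Suc N) x = 2 * int a - int (Suc N)" "potential (Suc N) y = 2 * int b - int (Suc N)"
        using potential_outer ab by blast+
      then show ?thesis using even_levels_ge[OF bb fe aug e t False ab] by simp
    next
      assume t: "ten x \<le> enat N" "\<not> ten y \<le> enat N"
      then show ?thesis using potential_sum_ge_mixed[OF bb fe aug e] False beta_eq_self[of N y] by simp
    next
      assume t: "\<not> ten x \<le> enat N" "ten y \<le> enat N"
      then show ?thesis using potential_sum_ge_mixed[OF bb fe aug e'] False beta_eq_self[of N x] by (simp add: add.commute)
    next
      assume "\<not> ten x \<le> enat N" "\<not> ten y \<le> enat N"
      then have "enat (Suc N) \<le> ten x" "enat (Suc N) \<le> ten y" by (cases "ten x"; cases "ten y"; simp)+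
      then show ?thesis using potential_sum_ge_above[OF e] potential_sum_ge_above[OF e']
        by (cases "level True x \<le> level True y") (auto simp: add.commute)
    qed
    then show ?thesis by simp
  qed
qed

section \<open>The joint induction and the conclusion\<close>

lemma based_below_and_feasible: "enat N \<le> min_aug \<Longrightarrow> based_below N \<and> feasible N"
proof (induction N)
  case 0
  then show ?case
    unfolding based_below_def feasible_def potential_def by (simp add: zero_enat_def[symmetric])
next
  case (Suc N)
  then have aug: "enat N < min_aug" by (metis enat_ord_simps(2) lessI less_le_trans)
  then have "based_below N" "feasible N" using Suc.IH by auto
  then show ?case using based_below_Suc feasible_Suc aug by blast
qed

lemma base_on_min_path:
  assumes p: "min_path v p" and tv: "ten v < min_aug" and u: "u \<in> set p" and tu: "ten u < min_aug"
  shows "base V E M u \<in> set p"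
proof -
  obtain n where n: "ten u = enat n" using tu by (cases "ten u") auto
  obtain N where N: "ten v = enat N" using tv by (cases "ten v") auto
  obtain k where k: "k < length p" "p ! k = u" using u unfolding in_set_conv_nth by auto
  show ?thesis
  proof (cases "N \<le> n")
    case True
    have "enat (Suc n) \<le> min_aug" using tu n by (cases min_aug) auto
    then have "well_based u" using based_below_and_feasible[of "Suc n"] n unfolding based_below_def by simp
    moreover have "min_path u (take (Suc k) p)" using min_path_prefix[OF p _ k(1)] N n True k by simp
    ultimately have "base V E M u \<in> set (take (Suc k) p)"
      unfolding well_based_def last_above_def by (metis nth_mem)
    then show ?thesis by (rule in_set_takeD)
  next
    case False
    have "enat N \<le> min_aug" using tv N by simp
    then have "tight n p" using min_path_tight[OF _ _ _ p, of N n] based_below_and_feasible N False by simp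
    then show ?thesis using tight_beta_mem[of n p k] beta_at_tenacity[OF n] k by simp
  qed
qed

end

theorem theorem5:
  fixes V :: "'a set" and E M :: "'a set set" and v :: 'a and p :: "'a list"
  assumes "finite_graph V E"
    and "matching E M"
    and "\<exists>f. unmatched V M f"
    and "v \<in> V"
    and "all_iterated_bases_defined V E M v"
    and "evenlevel_path V E M v p \<or> oddlevel_path V E M v p"
  shows "\<forall>u \<in> set p. \<forall>k b. iterated_base V E M u k b \<longrightarrow> b \<in> set p"
proof -
  interpret matched_graph V E M using assms(1,2) by unfold_locales
  have p: "min_path v p" using assms(6) by (simp add: min_path_iff)
  \<comment> \<open>Every derivation of an iterated base begins with the rule \<open>first\<close>,
    which carries this bound.\<close>
  have "ten v < min_aug" if "iterated_base V E M v k b" for k b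
    using that by induction (auto simp: tenacity_eq min_aug_def)
  then have tv: "ten v < min_aug" using assms(5) unfolding all_iterated_bases_defined_def by blast
  have "b \<in> set p" if "iterated_base V E M u k b" "u \<in> set p" for u k b
    using that
    by induction (auto intro: base_on_min_path[OF p tv] simp: tenacity_eq min_aug_def)
  then show ?thesis by blast
qed

end
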